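(* Let $X$ be a geodesic metric space with a navigable, undirected path system $\mathcal P$. For every constant $R\ge0$ there exist constants $\epsilon_0>0$, $A_0\ge1$, $L\ge0$ and a Morse gauge $M$ such that every special path $\gamma\in\mathcal P$ which is $L$-locally $(R;\epsilon_0,A_0;3,\mathcal P)$-weakly polygonally Morse is an $M$-Morse quasi-geodesic.
   Context: A $(\lambda,\kappa)$-quasi-geodesic ($\lambda\ge1,\kappa\ge0$) is a map $\gamma:I\to X$, $I\subseteq\mathbb R$ an interval, with $\frac1\lambda|t_1-t_2|-\kappa\le d(\gamma(t_1),\gamma(t_2))\le\lambda|t_1-t_2|+\kappa$. Convention: all quasi-geodesics are improved, i.e. continuous and such that the length of $\gamma|_{[t,t']}$ is at most $k_1d(\gamma(t),\gamma(t'))+k_2$, where $\kappa'=2(\lambda+\kappa)$, $k_1=\lambda(\lambda+\kappa)$, $k_2=(\lambda\kappa'+3)(\lambda+\kappa)$. For $p:[a,b]\to X$: $p^-=p(a)$, $p^+=p(b)$, $|p|=b-a$ is the domain length, $\|p\|$ the length, $p^{-1}$ the reversed path. A path system $\mathcal P$ on $X$ is a set of quasi-geodesic segments, all $(\lambda_0,\kappa_0)$-quasi-geodesics for a common pair, containing all trivial paths, closed under passing to subsegments, and containing for all $x,y\in X$ a path from $x$ to $y$. Its elements are called special paths. It is undirected if closed under $h\mapsto h^{-1}$. An $(n,\mathcal P)$-polygonal line is a concatenation of at most $n$ special paths. $\mathcal P$ is navigable if there are $C\ge1$ and an integer $k\ge1$ such that for every $r\ge C$, $m\in X$, $n$, and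 $(n,\mathcal P)$-polygonal line $\alpha$ with $d(\alpha,m)\ge r$ and $d(\alpha^\pm,m)\le2r$, there is a $(kn,\mathcal P)$-polygonal line $p$ with the same endpoints as $\alpha$, $\|p\|\le Cnr$, avoiding the closed ball $B(m,r/C)$. A quasi-geodesic $\gamma$ is $(\epsilon,A;n,\mathcal P)$-proportionally thin if for every $(n,\mathcal P)$-polygonal line $p$ from $\gamma^+$ to $\gamma^-$ with $\|p\|\le A\,d(\gamma^-,\gamma^+)$, the $\epsilon\,d(\gamma^-,\gamma^+)$-neighbourhood of $p$ contains $\gamma$. It is $(R;\epsilon,A;n,\mathcal P)$-weakly polygonally Morse if each subsegment $\gamma'$ of $\gamma$ with $|\gamma'|\ge R$ is $(\epsilon,A;n,\mathcal P)$-proportionally thin. A path $p:[a,b]\to X$ satisfies a property $L$-locally if $p|_{[t_1,t_2]}$ satisfies it for all $t_1,t_2\in[a,b]$ with $|t_1-t_2|\le L$. A Morse gauge is a function $M:\mathbb R_{\ge1}\times\mathbb R_{\ge0}\to\mathbb R_{\ge0}$, non-decreasing in each variable and continuous in the second. A quasi-geodesic $\gamma$ is $M$-Morse if every $(Q,q)$-quasi-geodesic with endpoints $\gamma(s),\gamma(t)$ lies in the $M(Q,q)$-neighbourhood of $\gamma|_{[s,t]}$. *)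

theory Defs
  imports "HOL-Analysis.Analysis" "HOL-Library.FuncSet"
begin

definition geodesic_space :: "'a::metric_space set \<Rightarrow> bool" where
  "geodesic_space X \<longleftrightarrow> (\<forall>x\<in>X. \<forall>y\<in>X. \<exists>g :: real \<Rightarrow> 'a.
      g 0 = x \<and> g (dist x y) = y \<and> g ` {0..dist x y} \<subseteq> X \<and>
      (\<forall>s\<in>{0..dist x y}. \<forall>t\<in>{0..dist x y}. dist (g s) (g t) = \<bar>s - t\<bar>))"

text \<open>The length is the supremum over all partitions; it is extended real valued, since a
  continuous path need not be rectifiable.\<close>

definition path_length :: "real \<Rightarrow> real \<Rightarrow> (real \<Rightarrow> 'a::metric_space) \<Rightarrow> ereal" where
  "path_length a b f =
     (SUP (n, t) \<in> {(n :: nat, t :: nat \<Rightarrow> real). mono_on {..n} t \<and> t 0 = a \<and> t n = b}.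
        ereal (\<Sum>i<n. dist (f (t i)) (f (t (Suc i)))))"

text \<open>The last two conjuncts make the quasi-geodesic an \<^emph>\<open>improved\<close> one. By convention every
  quasi-geodesic below is improved, including the test paths in the Morse property.\<close>

definition quasi_geodesic :: "real \<Rightarrow> real \<Rightarrow> real set \<Rightarrow> (real \<Rightarrow> 'a::metric_space) \<Rightarrow> bool" where
  "quasi_geodesic lam \<kappa> I \<gamma> \<longleftrightarrow>
     lam \<ge> 1 \<and> \<kappa> \<ge> 0 \<and> is_interval I \<and>
     (\<forall>t1\<in>I. \<forall>t2\<in>I. (1 / lam) * \<bar>t1 - t2\<bar> - \<kappa> \<le> dist (\<gamma> t1) (\<gamma> t2) \<and>
                       dist (\<gamma> t1) (\<gamma> t2) \<le> lam * \<bar>t1 - t2\<bar> + \<kappa>) \<and>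
     continuous_on I \<gamma> \<and>
     (let \<kappa>' = 2 * (lam + \<kappa>);
          k1 = lam * (lam + \<kappa>);
          k2 = (lam * \<kappa>' + 3) * (lam + \<kappa>)
      in \<forall>t\<in>I. \<forall>t'\<in>I. t \<le> t' \<longrightarrow>
           path_length t t' \<gamma> \<le> ereal (k1 * dist (\<gamma> t) (\<gamma> t') + k2))"

text \<open>A map from a compact interval to the space is recorded together with its domain. Requiring
  it to be \<^const>\<open>extensional\<close> makes the representation unique.\<close>

datatype 'a seg = Seg (dom_lo: real) (dom_hi: real) (seg_map: "real \<Rightarrow> 'a")

definition is_seg :: "'a seg \<Rightarrow> bool" where
  "is_seg p \<longleftrightarrow> dom_lo p \<le> dom_hi p \<and> seg_map p \<in> extensional {dom_lo p..dom_hi p}"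

definition seg_dom :: "'a seg \<Rightarrow> real set" where
  "seg_dom p = {dom_lo p..dom_hi p}"

definition seg_start :: "'a seg \<Rightarrow> 'a" where
  "seg_start p = seg_map p (dom_lo p)"

definition seg_end :: "'a seg \<Rightarrow> 'a" where
  "seg_end p = seg_map p (dom_hi p)"

definition seg_image :: "'a seg \<Rightarrow> 'a set" where
  "seg_image p = seg_map p ` seg_dom p"

definition dom_length :: "'a seg \<Rightarrow> real" where
  "dom_length p = dom_hi p - dom_lo p"

definition seg_length :: "'a::metric_space seg \<Rightarrow> ereal" where
  "seg_length p = path_length (dom_lo p) (dom_hi p) (seg_map p)"

definition subseg :: "'a seg \<Rightarrow> real \<Rightarrow> real \<Rightarrow> 'a seg" where
  "subseg p s t = Seg s t (restrict (seg_map p) {s..t})"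

definition trivial_seg :: "real \<Rightarrow> 'a \<Rightarrow> 'a seg" where
  "trivial_seg a x = Seg a a (\<lambda>t\<in>{a..a}. x)"

definition reverse_seg :: "'a seg \<Rightarrow> 'a seg" where
  "reverse_seg p = Seg (dom_lo p) (dom_hi p)
     (\<lambda>t\<in>{dom_lo p..dom_hi p}. seg_map p (dom_lo p + dom_hi p - t))"

text \<open>The domain of the second segment is translated so as to start where the first one ends.\<close>

definition concat_seg :: "'a seg \<Rightarrow> 'a seg \<Rightarrow> 'a seg" where
  "concat_seg p q = Seg (dom_lo p) (dom_hi p + dom_length q)
     (\<lambda>t\<in>{dom_lo p..dom_hi p + dom_length q}.
        if t \<le> dom_hi p then seg_map p t else seg_map q (t - dom_hi p + dom_lo q))"

definition quasi_geodesic_seg :: "real \<Rightarrow> real \<Rightarrow> 'a::metric_space seg \<Rightarrow> bool" where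
  "quasi_geodesic_seg lam \<kappa> p \<longleftrightarrow> is_seg p \<and> quasi_geodesic lam \<kappa> (seg_dom p) (seg_map p)"

definition path_system :: "'a::metric_space seg set \<Rightarrow> bool" where
  "path_system P \<longleftrightarrow>
     (\<exists>lam0 \<kappa>0. \<forall>p\<in>P. quasi_geodesic_seg lam0 \<kappa>0 p) \<and>
     (\<forall>a x. trivial_seg a x \<in> P) \<and>
     (\<forall>p\<in>P. \<forall>s\<in>seg_dom p. \<forall>t\<in>seg_dom p. s \<le> t \<longrightarrow> subseg p s t \<in> P) \<and>
     (\<forall>x y. \<exists>p\<in>P. seg_start p = x \<and> seg_end p = y)"

definition undirected :: "'a seg set \<Rightarrow> bool" where
  "undirected P \<longleftrightarrow> (\<forall>h\<in>P. reverse_seg h \<in> P)"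

inductive concat_of :: "'a seg set \<Rightarrow> nat \<Rightarrow> 'a seg \<Rightarrow> bool" for P where
  single: "h \<in> P \<Longrightarrow> concat_of P 1 h"
| snoc: "concat_of P n p \<Longrightarrow> h \<in> P \<Longrightarrow> seg_end p = seg_start h \<Longrightarrow>
         concat_of P (Suc n) (concat_seg p h)"

definition polygonal_line :: "nat \<Rightarrow> 'a seg set \<Rightarrow> 'a seg \<Rightarrow> bool" where
  "polygonal_line n P p \<longleftrightarrow> (\<exists>m\<le>n. concat_of P m p)"

definition navigable :: "'a::metric_space seg set \<Rightarrow> bool" where
  "navigable P \<longleftrightarrow> (\<exists>C\<ge>1. \<exists>k::nat\<ge>1. \<forall>r\<ge>C. \<forall>m n \<alpha>.
     polygonal_line n P \<alpha> \<and> infdist m (seg_image \<alpha>) \<ge> r \<and>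
     dist (seg_start \<alpha>) m \<le> 2 * r \<and> dist (seg_end \<alpha>) m \<le> 2 * r \<longrightarrow>
     (\<exists>p. polygonal_line (k * n) P p \<and>
          seg_start p = seg_start \<alpha> \<and> seg_end p = seg_end \<alpha> \<and>
          seg_length p \<le> ereal (C * real n * r) \<and>
          seg_image p \<inter> cball m (r / C) = {}))"

text \<open>Neighbourhoods are closed, so that the one of radius 0 of a set is not empty.\<close>

definition nbhd :: "real \<Rightarrow> 'a::metric_space set \<Rightarrow> 'a set" where
  "nbhd r A = (\<Union>x\<in>A. cball x r)"

definition proportionally_thin ::
    "real \<Rightarrow> real \<Rightarrow> nat \<Rightarrow> 'a::metric_space seg set \<Rightarrow> 'a seg \<Rightarrow> bool" where
  "proportionally_thin \<epsilon> A n P \<gamma> \<longleftrightarrow>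
     (\<forall>p. polygonal_line n P p \<and> seg_start p = seg_end \<gamma> \<and> seg_end p = seg_start \<gamma> \<and>
          seg_length p \<le> ereal (A * dist (seg_start \<gamma>) (seg_end \<gamma>)) \<longrightarrow>
          seg_image \<gamma> \<subseteq> nbhd (\<epsilon> * dist (seg_start \<gamma>) (seg_end \<gamma>)) (seg_image p))"

definition weakly_polygonally_Morse ::
    "real \<Rightarrow> real \<Rightarrow> real \<Rightarrow> nat \<Rightarrow> 'a::metric_space seg set \<Rightarrow> 'a seg \<Rightarrow> bool" where
  "weakly_polygonally_Morse R \<epsilon> A n P \<gamma> \<longleftrightarrow>
     (\<forall>s\<in>seg_dom \<gamma>. \<forall>t\<in>seg_dom \<gamma>. s \<le> t \<and> dom_length (subseg \<gamma> s t) \<ge> R \<longrightarrow>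
        proportionally_thin \<epsilon> A n P (subseg \<gamma> s t))"

definition locally_seg :: "real \<Rightarrow> ('a seg \<Rightarrow> bool) \<Rightarrow> 'a seg \<Rightarrow> bool" where
  "locally_seg L \<Phi> p \<longleftrightarrow>
     (\<forall>t1\<in>seg_dom p. \<forall>t2\<in>seg_dom p. t1 \<le> t2 \<and> \<bar>t1 - t2\<bar> \<le> L \<longrightarrow> \<Phi> (subseg p t1 t2))"

definition Morse_gauge :: "(real \<Rightarrow> real \<Rightarrow> real) \<Rightarrow> bool" where
  "Morse_gauge M \<longleftrightarrow>
     (\<forall>Q\<ge>1. \<forall>q\<ge>0. M Q q \<ge> 0) \<and>
     (\<forall>q\<ge>0. mono_on {1..} (\<lambda>Q. M Q q)) \<and>
     (\<forall>Q\<ge>1. mono_on {0..} (M Q)) \<and>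
     (\<forall>Q\<ge>1. continuous_on {0..} (M Q))"

text \<open>The test path may run between the two points in either direction.\<close>

definition Morse_quasi_geodesic ::
    "(real \<Rightarrow> real \<Rightarrow> real) \<Rightarrow> real set \<Rightarrow> (real \<Rightarrow> 'a::metric_space) \<Rightarrow> bool" where
  "Morse_quasi_geodesic M I \<gamma> \<longleftrightarrow>
     (\<exists>lam \<kappa>. quasi_geodesic lam \<kappa> I \<gamma>) \<and>
     (\<forall>Q\<ge>1. \<forall>q\<ge>0. \<forall>s\<in>I. \<forall>t\<in>I. \<forall>\<eta>.
        s \<le> t \<and> quasi_geodesic_seg Q q \<eta> \<and> {seg_start \<eta>, seg_end \<eta>} = {\<gamma> s, \<gamma> t} \<longrightarrow>
        seg_image \<eta> \<subseteq> nbhd (M Q q) (\<gamma> ` {s..t}))"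

end

theory Submission
  imports Defs
begin

text \<open>Suppose a quasi-geodesic \<open>\<eta>\<close> with endpoints on \<open>\<gamma>\<close>
  stays far from some point of \<open>\<gamma>\<close>. Replacing \<open>\<eta>\<close> by special paths gives a line with a number of
  pieces depending only on the constants of \<open>\<eta>\<close> that joins two points of \<open>\<gamma>\<close> on either side of
  \<open>\<gamma>(c)\<close> and avoids a large ball about \<open>\<gamma>(c)\<close>. At the cost of shrinking the ball by a constant factor
  per piece, and of moving \<open>c\<close>, the line can be cut down to five pieces. Extending this line along
  \<open>\<gamma>\<close> towards a ball of a fixed radius and applying navigability produces a line with a universal
  number of pieces and universally bounded length. Connecting its vertices to suitable points of
  \<open>\<gamma>\<close> splits it into 3-lines at a scale where \<open>\<gamma>\<close> is known to be thin, and thinness then fails.\<close>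

subsection \<open>Segments and special paths\<close>

text \<open>The obstacle is the order of the quantifiers: \<open>\<epsilon>0\<close>,
  \<open>A0\<close> and \<open>L\<close> are fixed before the constants of \<eta>, whereas a line
  that follows \<eta> has a number of pieces growing with \<open>Q\<close>, and navigability bounds
  pieces and length only in proportion to that number. Shortening the line first moves the
  dependence on \<open>Q\<close> into the radius, where the gauge absorbs it. Cutting n pieces after
  the third and completing both parts by two pieces yields lines of 5 and n - 1 pieces, a gain only
  from n = 6 on; hence five. The contradiction is an exchange of sides. A special path ending at
  \<gamma>(t) cannot come near both \<gamma>(t - D) and \<gamma>(t + D). The path from the first
  vertex of the final line comes from the left, the one from the last vertex from the right, yet the
  side cannot change along an edge that avoids the ball. The fixed radius is such that the ball
  contains a test point of \<gamma> for every vertex.\<close>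

lemma partition_sum_le_path_length:
  assumes "mono_on {..n} t" "t 0 = a" "t n = b"
  shows "ereal (\<Sum>i<n. dist (f (t i)) (f (t (Suc i)))) \<le> path_length a b f"
  unfolding path_length_def by (rule SUP_upper2[of "(n, t)"]) (use assms in auto)

lemma path_length_leI:
  assumes "\<And>n t. mono_on {..n} t \<Longrightarrow> t 0 = a \<Longrightarrow> t n = b \<Longrightarrow>
    ereal (\<Sum>i<n. dist (f (t i)) (f (t (Suc i)))) \<le> B"
  shows "path_length a b f \<le> B"
  unfolding path_length_def by (rule SUP_least) (use assms in auto)

lemma dist_le_path_length:
  assumes "a \<le> t" "t \<le> b"
  shows "ereal (dist (f a) (f t)) \<le> path_length a b f"
proof -
  define s where "s i = (if i = 0 then a else if i = 1 then t else b)" for i :: nat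
  have "mono_on {..2} s" using assms by (auto simp: mono_on_def s_def)
  then have "ereal (\<Sum>i<2. dist (f (s i)) (f (s (Suc i)))) \<le> path_length a b f"
    by (rule partition_sum_le_path_length) (auto simp: s_def)
  then have "ereal (dist (f a) (f t) + dist (f t) (f b)) \<le> path_length a b f"
    by (simp add: numeral_2_eq_2 s_def)
  then show ?thesis
    by (rule order_trans[rotated]) simp
qed

text \<open>Clamping the partition points at c from above and from below gives two partitions with
  the same index set, so c need not be inserted; the triangle inequality serves only the step that
  jumps over c.\<close>

lemma path_length_append_le:
  assumes "a \<le> c" "c \<le> b"
  shows "path_length a b f \<le> path_length a c f + path_length c b f"
proof (rule path_length_leI)
  fix n :: nat and t :: "nat \<Rightarrow> real"
  assume t: "mono_on {..n} t" "t 0 = a" "t n = b"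
  let ?l = "\<lambda>i. min (t i) c" and ?r = "\<lambda>i. max (t i) c"
  have l: "mono_on {..n} ?l" and r: "mono_on {..n} ?r"
    using t(1) by (force simp: mono_on_def min_def max_def)+
  have "(\<Sum>i<n. dist (f (t i)) (f (t (Suc i)))) \<le>
      (\<Sum>i<n. dist (f (?l i)) (f (?l (Suc i)))) + (\<Sum>i<n. dist (f (?r i)) (f (?r (Suc i))))"
    unfolding sum.distrib[symmetric]
  proof (rule sum_mono)
    fix i assume "i \<in> {..<n}"
    then have "t i \<le> t (Suc i)" using t(1) by (auto simp: mono_on_def)
    then show "dist (f (t i)) (f (t (Suc i))) \<le>
        dist (f (?l i)) (f (?l (Suc i))) + dist (f (?r i)) (f (?r (Suc i)))"
      using dist_triangle[of "f (t i)" "f (t (Suc i))" "f c"] by (auto simp: min_def max_def)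
  qed
  then have "ereal (\<Sum>i<n. dist (f (t i)) (f (t (Suc i)))) \<le>
      ereal (\<Sum>i<n. dist (f (?l i)) (f (?l (Suc i)))) + ereal (\<Sum>i<n. dist (f (?r i)) (f (?r (Suc i))))"
    by simp
  also have "\<dots> \<le> path_length a c f + path_length c b f"
    by (intro add_mono partition_sum_le_path_length[OF l] partition_sum_le_path_length[OF r])
      (use t assms in auto)
  finally show "ereal (\<Sum>i<n. dist (f (t i)) (f (t (Suc i)))) \<le> path_length a c f + path_length c b f" .
qed

lemma path_length_translate_le:
  assumes "\<And>t. a \<le> t \<Longrightarrow> t \<le> b \<Longrightarrow> f t = g (t + c)"
  shows "path_length a b f \<le> path_length (a + c) (b + c) g"
proof (rule path_length_leI)
  fix n :: nat and t :: "nat \<Rightarrow> real"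
  assume t: "mono_on {..n} t" "t 0 = a" "t n = b"
  then have "a \<le> t i" "t i \<le> b" if "i \<le> n" for i
    using that by (auto simp: mono_on_def)
  then have "(\<Sum>i<n. dist (f (t i)) (f (t (Suc i)))) =
      (\<Sum>i<n. dist (g (t i + c)) (g (t (Suc i) + c)))"
    by (intro sum.cong) (auto simp: assms)
  moreover have "mono_on {..n} (\<lambda>i. t i + c)"
    using t(1) by (auto simp: mono_on_def)
  ultimately show "ereal (\<Sum>i<n. dist (f (t i)) (f (t (Suc i)))) \<le> path_length (a + c) (b + c) g"
    using partition_sum_le_path_length[of n "\<lambda>i. t i + c" "a + c" "b + c" g] t by simp
qed

section \<open>Operations on segments\<close>

lemma seg_start_in_image: "is_seg p \<Longrightarrow> seg_start p \<in> seg_image p"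
  and seg_end_in_image: "is_seg p \<Longrightarrow> seg_end p \<in> seg_image p"
  by (auto simp: is_seg_def seg_start_def seg_end_def seg_image_def seg_dom_def)

lemma seg_subseg:
  assumes "s \<le> t"
  shows "seg_start (subseg p s t) = seg_map p s" "seg_end (subseg p s t) = seg_map p t"
    "seg_image (subseg p s t) = seg_map p ` {s..t}" "seg_dom (subseg p s t) = {s..t}"
  using assms by (auto simp: subseg_def seg_start_def seg_end_def seg_image_def seg_dom_def)

lemma subseg_whole_subseg: "subseg (subseg p s t) s t = subseg p s t"
  by (simp add: subseg_def)

lemma seg_trivial_seg:
  "seg_start (trivial_seg a x) = x" "seg_end (trivial_seg a x) = x" "seg_image (trivial_seg a x) = {x}"
  by (auto simp: trivial_seg_def seg_start_def seg_end_def seg_image_def seg_dom_def)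

lemma seg_reverse_seg:
  assumes "is_seg p"
  shows "seg_start (reverse_seg p) = seg_end p" "seg_end (reverse_seg p) = seg_start p"
    "seg_image (reverse_seg p) = seg_image p"
proof -
  show "seg_start (reverse_seg p) = seg_end p" "seg_end (reverse_seg p) = seg_start p"
    using assms by (auto simp: is_seg_def reverse_seg_def seg_start_def seg_end_def)
  have "seg_image (reverse_seg p) = seg_map p ` ((\<lambda>t. (dom_lo p + dom_hi p) - t) ` {dom_lo p..dom_hi p})"
    by (simp add: seg_image_def seg_dom_def reverse_seg_def image_image del: image_diff_atLeastAtMost)
  moreover have "(\<lambda>t. (dom_lo p + dom_hi p) - t) ` {dom_lo p..dom_hi p} = {dom_lo p..dom_hi p}"
    by simp
  ultimately show "seg_image (reverse_seg p) = seg_image p"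
    by (simp only: seg_image_def seg_dom_def)
qed

lemma is_seg_concat_seg: "is_seg p \<Longrightarrow> is_seg q \<Longrightarrow> is_seg (concat_seg p q)"
  by (auto simp: is_seg_def concat_seg_def dom_length_def)

lemma seg_concat_seg:
  assumes "is_seg p" "is_seg q" "seg_end p = seg_start q"
  shows "seg_start (concat_seg p q) = seg_start p" "seg_end (concat_seg p q) = seg_end q"
    "seg_image (concat_seg p q) = seg_image p \<union> seg_image q"
    "seg_length (concat_seg p q) \<le> seg_length p + seg_length q"
proof -
  obtain a b f where p: "p = Seg a b f" by (cases p)
  obtain c d g where q: "q = Seg c d g" by (cases q)
  have ab: "a \<le> b" "c \<le> d" "f b = g c"
    using assms by (auto simp: p q is_seg_def seg_start_def seg_end_def)
  let ?h = "\<lambda>t\<in>{a..b + (d - c)}. if t \<le> b then f t else g (t - b + c)"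
  have pq: "concat_seg p q = Seg a (b + (d - c)) ?h"
    by (simp add: p q concat_seg_def dom_length_def cong: if_cong)
  have hf: "?h t = f t" if "a \<le> t" "t \<le> b" for t using ab that by auto
  have hg: "?h t = g (t + (c - b))" if "b \<le> t" "t \<le> b + (d - c)" for t
    using ab that by (cases "t = b") (auto simp: algebra_simps)
  show "seg_start (concat_seg p q) = seg_start p"
    unfolding pq seg_start_def seg.sel using hf[of a] ab by (simp add: p)
  have "?h (b + (d - c)) = g (b + (d - c) + (c - b))" by (rule hg) (use ab in auto)
  also have "\<dots> = g d" by simp
  finally show "seg_end (concat_seg p q) = seg_end q"
    unfolding pq seg_end_def seg.sel by (simp only: q seg.sel)
  have f: "?h ` {a..b} = f ` {a..b}" using hf by (intro image_cong) auto
  have "?h ` {b..b + (d - c)} = g ` ((\<lambda>t. t + (c - b)) ` {b..b + (d - c)})"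
    unfolding image_image using hg by (intro image_cong) auto
  also have "(\<lambda>t. t + (c - b)) ` {b..b + (d - c)} = {c..d}" by simp
  finally have "?h ` ({a..b} \<union> {b..b + (d - c)}) = f ` {a..b} \<union> g ` {c..d}"
    by (simp only: image_Un f)
  also have "{a..b} \<union> {b..b + (d - c)} = {a..b + (d - c)}" using ab by auto
  finally show "seg_image (concat_seg p q) = seg_image p \<union> seg_image q"
    by (simp only: pq seg_image_def seg_dom_def seg.sel) (simp only: p q seg.sel)
  have "path_length a (b + (d - c)) ?h \<le> path_length a b ?h + path_length b (b + (d - c)) ?h"
    by (rule path_length_append_le) (use ab in auto)
  also have "path_length a b ?h \<le> path_length (a + 0) (b + 0) f"
    by (rule path_length_translate_le) (use hf in auto)
  also have "path_length b (b + (d - c)) ?h \<le> path_length (b + (c - b)) (b + (d - c) + (c - b)) g"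
    by (rule path_length_translate_le) (use hg in auto)
  finally show "seg_length (concat_seg p q) \<le> seg_length p + seg_length q"
    unfolding seg_length_def pq seg.sel by (simp add: p q add_mono)
qed

text \<open>Turns the length bound of navigability into a bound on positions, the only form in which
  it is used.\<close>

lemma dist_seg_start_le_seg_length:
  assumes "x \<in> seg_image p" "seg_length p \<le> ereal l"
  shows "dist (seg_start p) x \<le> l"
proof -
  obtain t where t: "dom_lo p \<le> t" "t \<le> dom_hi p" "x = seg_map p t"
    using assms(1) by (auto simp: seg_image_def seg_dom_def)
  have "ereal (dist (seg_start p) x) \<le> ereal l"
    using dist_le_path_length[OF t(1,2), of "seg_map p"] assms(2)
    unfolding seg_length_def t(3) seg_start_def by (rule order_trans)
  then show ?thesis by simp
qed

lemma IVT_between: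
  fixes f :: "real \<Rightarrow> real"
  assumes "continuous_on {a..b} f" "a \<le> b" "min (f a) (f b) \<le> y" "y \<le> max (f a) (f b)"
  shows "\<exists>t\<in>{a..b}. f t = y"
  using IVT'[of f a y b] IVT2'[of f b y a] assms by (force simp: min_def max_def split: if_splits)

text \<open>The constant \<open>H\<close> gathers \<open>\<lambda>\<close>, \<open>\<kappa>\<close>, \<open>k\<^sub>1\<close>, \<open>k\<^sub>2\<close>: above scale 1 the additive
  constants of a quasi-geodesic are absorbed into a multiplicative one.\<close>

locale special_paths =
  fixes P :: "'a::metric_space seg set" and H :: real
  assumes H_ge_2: "2 \<le> H"
    and is_seg: "h \<in> P \<Longrightarrow> is_seg h"
    and continuous: "h \<in> P \<Longrightarrow> continuous_on (seg_dom h) (seg_map h)"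
    and trivial: "trivial_seg a x \<in> P"
    and subseg: "h \<in> P \<Longrightarrow> s \<in> seg_dom h \<Longrightarrow> t \<in> seg_dom h \<Longrightarrow> s \<le> t \<Longrightarrow> subseg h s t \<in> P"
    and connected: "\<exists>h\<in>P. seg_start h = x \<and> seg_end h = y"
    and reverse: "h \<in> P \<Longrightarrow> reverse_seg h \<in> P"
    and upper: "h \<in> P \<Longrightarrow> s \<in> seg_dom h \<Longrightarrow> t \<in> seg_dom h \<Longrightarrow> \<bar>s - t\<bar> \<le> d \<Longrightarrow> 1 \<le> d \<Longrightarrow>
      dist (seg_map h s) (seg_map h t) \<le> H * d"
    and lower: "h \<in> P \<Longrightarrow> s \<in> seg_dom h \<Longrightarrow> t \<in> seg_dom h \<Longrightarrow>
      dist (seg_map h s) (seg_map h t) \<le> d \<Longrightarrow> 1 \<le> d \<Longrightarrow> \<bar>s - t\<bar> \<le> H * d"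
    and length_le: "h \<in> P \<Longrightarrow> dist (seg_start h) (seg_end h) \<le> d \<Longrightarrow> 1 \<le> d \<Longrightarrow>
      seg_length h \<le> ereal (H * d)"
begin

text \<open>An n-piece line inside U from x to y becomes \<open>(x, y) \<in> linked U ^^ n\<close>:
  parametrisations and lengths are forgotten, and concatenation is relational composition.\<close>

definition linked :: "'a set \<Rightarrow> ('a \<times> 'a) set" where
  "linked U = {(x, y). \<exists>h\<in>P. seg_start h = x \<and> seg_end h = y \<and> seg_image h \<subseteq> U}"

lemma linkedI: "h \<in> P \<Longrightarrow> seg_image h \<subseteq> U \<Longrightarrow> (seg_start h, seg_end h) \<in> linked U"
  by (auto simp: linked_def)

lemma linked_mono: "U \<subseteq> V \<Longrightarrow> linked U \<subseteq> linked V"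
  by (auto simp: linked_def)

lemma linked_power_mono:
  assumes "(x, y) \<in> linked U ^^ n" "U \<subseteq> V"
  shows "(x, y) \<in> linked V ^^ n"
proof -
  have "linked U ^^ n \<subseteq> linked V ^^ n"
    using linked_mono[OF assms(2)] by (induction n) auto
  then show ?thesis using assms(1) by blast
qed

lemma linked_sym: "(x, y) \<in> linked U \<Longrightarrow> (y, x) \<in> linked U"
  using is_seg reverse by (auto simp: linked_def) (metis seg_reverse_seg)

lemma linked_refl: "x \<in> U \<Longrightarrow> (x, x) \<in> linked U"
  using linkedI[OF trivial[of 0 x], of U] by (simp add: seg_trivial_seg)

lemma linked_in: "(x, y) \<in> linked U \<Longrightarrow> x \<in> U \<and> y \<in> U"
  using is_seg seg_start_in_image seg_end_in_image by (fastforce simp: linked_def)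

text \<open>Trivial paths at x fill up the missing pieces, so "at most m pieces" can be read as
  "exactly m".\<close>

lemma linked_power_pad:
  assumes "(x, y) \<in> linked U ^^ n" "n \<le> m" "x \<in> U"
  shows "(x, y) \<in> linked U ^^ m"
proof -
  have "(x, x) \<in> linked U ^^ k" for k
    using linked_refl[OF assms(3)] by (induction k) auto
  then have "(x, y) \<in> linked U ^^ ((m - n) + n)"
    using assms(1) unfolding relpow_add by blast
  then show ?thesis using assms(2) by simp
qed

lemma linked_power_if_concat_of:
  assumes "concat_of P n p"
  shows "is_seg p \<and> (seg_image p \<subseteq> U \<longrightarrow> (seg_start p, seg_end p) \<in> linked U ^^ n)"
  using assms
proof (induction rule: concat_of.induct)
  case (single h)
  then show ?case using linkedI[of h U] is_seg[of h] by simp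
next
  case (snoc n p h)
  have h: "is_seg h" using is_seg snoc by auto
  then show ?case
    using snoc linkedI[of h U] by (auto simp: seg_concat_seg is_seg_concat_seg intro: relpow_Suc_I)
qed

text \<open>The exponent is a successor because the zeroth power is the identity, whereas every
  concatenation has at least one piece.\<close>

lemma concat_of_if_linked_power:
  assumes "(x, y) \<in> linked U ^^ Suc n"
  shows "\<exists>p. concat_of P (Suc n) p \<and> seg_start p = x \<and> seg_end p = y \<and> seg_image p \<subseteq> U"
  using assms
proof (induction n arbitrary: y)
  case 0
  then show ?case using concat_of.single[of _ P] by (auto simp: linked_def)
next
  case (Suc n)
  then obtain z where z: "(x, z) \<in> linked U ^^ Suc n" "(z, y) \<in> linked U"
    by (metis relpow_Suc_E)
  then obtain p where p: "concat_of P (Suc n) p" "seg_start p = x" "seg_end p = z" "seg_image p \<subseteq> U"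
    using Suc.IH by blast
  obtain h where h: "h \<in> P" "seg_start h = z" "seg_end h = y" "seg_image h \<subseteq> U"
    using z(2) by (auto simp: linked_def)
  have "is_seg p" "is_seg h" using linked_power_if_concat_of[OF p(1)] is_seg h(1) by auto
  then have "concat_of P (Suc (Suc n)) (concat_seg p h) \<and> seg_start (concat_seg p h) = x \<and>
      seg_end (concat_seg p h) = y \<and> seg_image (concat_seg p h) \<subseteq> U"
    using p h by (auto simp: seg_concat_seg intro: concat_of.snoc)
  then show ?case by blast
qed

text \<open>Passing to the domain by \<open>lower\<close> and back by \<open>upper\<close> costs a
  factor H each; hence the \<open>H\<^sup>2\<close> whenever a gap is bridged.\<close>

lemma dist_in_special_path:
  assumes "h \<in> P" "dist (seg_start h) (seg_end h) \<le> d" "1 \<le> d" "x \<in> seg_image h"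
  shows "dist (seg_start h) x \<le> H\<^sup>2 * d" "dist (seg_end h) x \<le> H\<^sup>2 * d"
proof -
  obtain t where t: "t \<in> seg_dom h" "x = seg_map h t"
    using assms(4) by (auto simp: seg_image_def)
  have lo: "dom_lo h \<in> seg_dom h" and hi: "dom_hi h \<in> seg_dom h"
    using is_seg[OF assms(1)] by (auto simp: is_seg_def seg_dom_def)
  have "\<bar>dom_lo h - dom_hi h\<bar> \<le> H * d"
    using lower[OF assms(1) lo hi _ assms(3)] assms(2) by (simp add: seg_start_def seg_end_def)
  then have "\<bar>dom_lo h - t\<bar> \<le> H * d" "\<bar>dom_hi h - t\<bar> \<le> H * d"
    using t(1) by (auto simp: seg_dom_def)
  moreover have "1 \<le> H * d" using H_ge_2 assms(3) mult_mono[of 1 H 1 d] by simp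
  ultimately show "dist (seg_start h) x \<le> H\<^sup>2 * d" "dist (seg_end h) x \<le> H\<^sup>2 * d"
    using upper[OF assms(1) lo t(1)] upper[OF assms(1) hi t(1)] t(2)
    by (auto simp: seg_start_def seg_end_def power2_eq_square mult.assoc)
qed

lemma far_if_apart:
  assumes "h \<in> P" "s \<in> seg_dom h" "t \<in> seg_dom h" "H * d < \<bar>s - t\<bar>" "1 \<le> d"
  shows "d < dist (seg_map h s) (seg_map h t)"
  using lower[OF assms(1-3) _ assms(5)] assms(4) by fastforce

lemma apart_if_far:
  assumes "h \<in> P" "s \<in> seg_dom h" "t \<in> seg_dom h" "H * d < dist (seg_map h s) (seg_map h t)" "1 \<le> d"
  shows "d < \<bar>s - t\<bar>"
  using upper[OF assms(1-3) _ assms(5)] assms(4) by fastforce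

end

subsection \<open>Shortening a line around a point\<close>

context special_paths begin

definition away :: "'a \<Rightarrow> real \<Rightarrow> 'a set" where
  "away m r = {z. r \<le> dist m z}"

lemma linked_power_in:
  assumes "(x, y) \<in> linked U ^^ n" "0 < n"
  shows "x \<in> U" "y \<in> U"
proof -
  obtain f where f: "f 0 = x" "f n = y" "\<forall>i<n. (f i, f (Suc i)) \<in> linked U"
    using assms(1) by (auto simp: relpow_fun_conv)
  show "x \<in> U" using f linked_in[of "f 0" "f (Suc 0)"] assms(2) by auto
  obtain m where "n = Suc m" using assms(2) gr0_implies_Suc by blast
  then show "y \<in> U" using f linked_in[of "f m" "f (Suc m)"] by auto
qed

lemma linked_power_trans:
  "(x, y) \<in> linked U ^^ n \<Longrightarrow> (y, z) \<in> linked U ^^ m \<Longrightarrow> (x, z) \<in> linked U ^^ (n + m)"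
  by (auto simp: relpow_add)

lemma linked_subseg:
  assumes "h \<in> P" "s \<in> seg_dom h" "t \<in> seg_dom h" "s \<le> t" "seg_map h ` {s..t} \<subseteq> U"
  shows "(seg_map h s, seg_map h t) \<in> linked U"
  using linkedI[OF subseg[OF assms(1-4)], of U] assms by (simp add: seg_subseg)

lemma linked_if_close:
  assumes "dist x y \<le> d" "1 \<le> d" "cball x (H\<^sup>2 * d) \<subseteq> U"
  shows "(x, y) \<in> linked U"
proof -
  obtain h where h: "h \<in> P" "seg_start h = x" "seg_end h = y" using connected by blast
  then have "seg_image h \<subseteq> U"
    using dist_in_special_path(1)[OF h(1)] assms by (auto simp: subset_iff)
  then show ?thesis using linkedI[OF h(1)] h by simp
qed

lemma compact_seg_image: "h \<in> P \<Longrightarrow> compact (seg_image h)"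
  using continuous[of h] by (simp add: seg_image_def compact_continuous_image seg_dom_def)

lemma in_seg_dom_between: "s \<in> seg_dom h \<Longrightarrow> t \<in> seg_dom h \<Longrightarrow> s \<le> u \<Longrightarrow> u \<le> t \<Longrightarrow> u \<in> seg_dom h"
  by (auto simp: seg_dom_def)

lemma continuous_dist_special:
  assumes "h \<in> P" "s \<in> seg_dom h" "t \<in> seg_dom h"
  shows "continuous_on {s..t} (\<lambda>u. dist m (seg_map h u))"
  by (intro continuous_intros continuous_on_subset[OF continuous[OF assms(1)]])
    (use assms in \<open>auto simp: seg_dom_def\<close>)

text \<open>The times at which h is \<delta>-close to A form a compact set containing the last time;
  T is its minimum. Before T the bound holds against all of A, so a centre on \<gamma> can be chosen
  after T is known.\<close>

lemma first_approach:
  assumes h: "h \<in> P" and A: "compact A" "seg_end h \<in> A" and "0 \<le> \<delta>"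
  obtains T y where "T \<in> seg_dom h" "y \<in> A" "dist (seg_map h T) y \<le> \<delta>"
    "\<And>t x. t \<in> seg_dom h \<Longrightarrow> t < T \<Longrightarrow> x \<in> A \<Longrightarrow> \<delta> < dist x (seg_map h t)"
proof -
  let ?S = "{t \<in> seg_dom h. infdist (seg_map h t) A \<le> \<delta>}"
  have "continuous_on (seg_dom h) (\<lambda>t. infdist (seg_map h t) A)"
    by (intro continuous_intros continuous[OF h])
  then have "closed ?S"
    using continuous_closed_preimage[of "seg_dom h" "\<lambda>t. infdist (seg_map h t) A" "{..\<delta>}"]
    by (simp add: seg_dom_def vimage_def Int_def)
  moreover have "bounded ?S"
    by (rule bounded_subset[of "seg_dom h"]) (auto simp: seg_dom_def)
  moreover have "dom_hi h \<in> ?S"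
    using is_seg[OF h] A assms(4) by (auto simp: is_seg_def seg_dom_def seg_end_def)
  ultimately obtain T where T: "T \<in> ?S" "\<And>t. t \<in> ?S \<Longrightarrow> T \<le> t"
    using compact_attains_inf[of ?S] compact_eq_bounded_closed by blast
  obtain y where "y \<in> A" "\<And>z. z \<in> A \<Longrightarrow> dist (seg_map h T) y \<le> dist (seg_map h T) z"
    using continuous_attains_inf[OF A(1), of "dist (seg_map h T)"] A(2)
      continuous_on_dist[OF continuous_on_const continuous_on_id, of A "seg_map h T"] by auto
  moreover from this have "dist (seg_map h T) y \<le> infdist (seg_map h T) A"
    by (auto simp: infdist_def intro!: cINF_greatest)
  moreover have "\<delta> < dist x (seg_map h t)" if "t \<in> seg_dom h" "t < T" "x \<in> A" for t x
    using T(2)[of t] that infdist_le[OF that(3), of "seg_map h t"] by (force simp: dist_commute)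
  ultimately show thesis using that T(1) by auto
qed

text \<open>A special path from the third vertex to the centre of the ball first comes close to \<open>\<gamma>\<close> at
  some \<open>\<gamma>(e)\<close>, and together with one of the two halves of the line it again surrounds a point of
  \<open>\<gamma>\<close>. The centre is moved if \<open>\<gamma>(e)\<close> is too close to it.\<close>

lemma shorten_line:
  assumes \<gamma>: "\<gamma> \<in> P" and abc: "a \<in> seg_dom \<gamma>" "b \<in> seg_dom \<gamma>" "a \<le> c" "c \<le> b"
    and "1 \<le> \<delta>" "6 \<le> n"
    and line: "(seg_map \<gamma> a, seg_map \<gamma> b) \<in> linked (away (seg_map \<gamma> c) (4 * H ^ 4 * \<delta>)) ^^ n"
  shows "\<exists>a' c' b'. a' \<in> seg_dom \<gamma> \<and> b' \<in> seg_dom \<gamma> \<and> a' \<le> c' \<and> c' \<le> b' \<and>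
    (seg_map \<gamma> a', seg_map \<gamma> b') \<in> linked (away (seg_map \<gamma> c') \<delta>) ^^ (n - 1)"
proof -
  define g where "g = seg_map \<gamma>"
  define U where "U = away (g c) (4 * H ^ 4 * \<delta>)"
  \<comment> \<open>Each part will receive two more pieces, giving 5 and n - 1; both are at most n -
    1 because 6 \<le> n.\<close>
  have "(g a, g b) \<in> linked U ^^ (3 + (n - 3))"
    using line assms(7) by (simp add: g_def U_def)
  then obtain v where v: "(g a, v) \<in> linked U ^^ 3" "(v, g b) \<in> linked U ^^ (n - 3)"
    by (subst (asm) relpow_add) blast
  have in_U: "v \<in> U" "g b \<in> U"
    using linked_power_in[OF v(1)] linked_power_in[OF v(2)] assms(7) by auto
  have c: "c \<in> seg_dom \<gamma>" using in_seg_dom_between abc by blast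
  obtain h where h: "h \<in> P" "seg_start h = v" "seg_end h = g c" using connected by blast
  obtain T y where T: "T \<in> seg_dom h" "y \<in> seg_image \<gamma>" "dist (seg_map h T) y \<le> \<delta>"
    and before_T: "\<And>t x. t \<in> seg_dom h \<Longrightarrow> t < T \<Longrightarrow> x \<in> seg_image \<gamma> \<Longrightarrow> \<delta> < dist x (seg_map h t)"
    using first_approach[OF h(1) compact_seg_image[OF \<gamma>], of \<delta>] c assms(6)
    by (auto simp: h(3) seg_image_def g_def)
  obtain e where e: "e \<in> seg_dom \<gamma>" "y = g e" using T(2) by (auto simp: seg_image_def g_def)
  have H2: "4 \<le> H\<^sup>2" using H_ge_2 power_mono[of 2 H 2] by simp
  have est: "\<delta> \<le> H\<^sup>2 * \<delta>" "4 * (H\<^sup>2 * \<delta>) \<le> H ^ 4 * \<delta>"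
    using H_ge_2 H2 assms(6) mult_right_mono[of 4 "H\<^sup>2" "H\<^sup>2 * \<delta>"] mult_right_mono[of 4 "H\<^sup>2" \<delta>]
    by (simp_all add: power4_eq_xxxx power2_eq_square mult.assoc zero_le_mult_iff)
  \<comment> \<open>The bound \<open>H\<^sup>2 * \<delta> + \<delta>\<close> leaves room for a
    special path that bridges a gap \<delta> at \<open>g e\<close>. If c violates it, the centre
    moves towards b by distance \<open>3 * (H ^ 4 * \<delta>)\<close>: far enough from
    \<open>g e\<close>, and so little that the old line, at distance
    \<open>4 * H ^ 4 * \<delta>\<close> from \<open>g c\<close>, stays \<delta> away.\<close>
  have "\<exists>c'\<in>{c..b}. dist (g c) (g c') \<le> 3 * (H ^ 4 * \<delta>) \<and> H\<^sup>2 * \<delta> + \<delta> \<le> dist (g e) (g c')"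
  proof (cases "H\<^sup>2 * \<delta> + \<delta> \<le> dist (g e) (g c)")
    case True
    then show ?thesis using abc est assms(6) by (intro bexI[of _ c]) auto
  next
    case False
    have "4 * (H ^ 4 * \<delta>) \<le> dist (g c) (g b)" using in_U by (simp add: U_def away_def mult.assoc)
    then obtain c' where c': "c' \<in> {c..b}" "dist (g c) (g c') = 3 * (H ^ 4 * \<delta>)"
      using IVT'[OF _ _ abc(4), of "\<lambda>t. dist (g c) (g t)" "3 * (H ^ 4 * \<delta>)"]
        continuous_dist_special[OF \<gamma> c abc(2)] est assms(6) by (auto simp: g_def)
    have "dist (g c) (g c') \<le> dist (g e) (g c) + dist (g e) (g c')"
      by (metis dist_commute dist_triangle)
    then have "H\<^sup>2 * \<delta> + \<delta> \<le> dist (g e) (g c')" using c'(2) False est assms(6) by linarith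
    then show ?thesis using c' by (intro bexI[of _ c']) auto
  qed
  then obtain c' where c': "c \<le> c'" "c' \<le> b" "dist (g c) (g c') \<le> 3 * (H ^ 4 * \<delta>)"
    "H\<^sup>2 * \<delta> + \<delta> \<le> dist (g e) (g c')" by auto
  define V where "V = away (g c') \<delta>"
  have "U \<subseteq> V"
  proof
    fix z assume "z \<in> U"
    then have "4 * (H ^ 4 * \<delta>) \<le> dist (g c) z" by (simp add: U_def away_def mult.assoc)
    also have "\<dots> \<le> dist (g c) (g c') + dist (g c') z" by (rule dist_triangle)
    finally have "\<delta> \<le> dist (g c') z" using c'(3) est assms(6) by linarith
    then show "z \<in> V" by (simp add: V_def away_def)
  qed
  have g_e: "(g e, seg_map h T) \<in> linked V"
  proof (rule linked_if_close)
    show "cball (g e) (H\<^sup>2 * \<delta>) \<subseteq> V"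
    proof
      fix z assume "z \<in> cball (g e) (H\<^sup>2 * \<delta>)"
      then show "z \<in> V"
        using dist_triangle[of "g e" "g c'" z] c'(4) by (simp add: V_def away_def dist_commute)
    qed
  qed (use T e assms(6) in \<open>simp_all add: dist_commute\<close>)
  have "(v, seg_map h T) \<in> linked V"
  proof -
    have lo: "dom_lo h \<in> seg_dom h" "dom_lo h \<le> T" "v = seg_map h (dom_lo h)"
      using is_seg[OF h(1)] T(1) h(2) by (auto simp: is_seg_def seg_dom_def seg_start_def)
    have "seg_map h t \<in> V" if "dom_lo h \<le> t" "t \<le> T" for t
    proof (cases "t = T")
      case True
      then show ?thesis using linked_in[OF g_e] by simp
    next
      case False
      moreover have "t \<in> seg_dom h" using that lo(1) T(1) in_seg_dom_between by blast
      moreover have "g c' \<in> seg_image \<gamma>"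
        using in_seg_dom_between[OF c abc(2)] c' by (auto simp: g_def seg_image_def)
      ultimately show ?thesis using before_T[of t "g c'"] that by (simp add: V_def away_def)
    qed
    then have "seg_map h ` {dom_lo h..T} \<subseteq> V" by auto
    then show ?thesis using linked_subseg[OF h(1) lo(1) T(1) lo(2)] lo(3) by simp
  qed
  then have ve: "(v, g e) \<in> linked V ^^ 2" "(g e, v) \<in> linked V ^^ 2"
    using g_e linked_sym[OF g_e] linked_sym by (auto simp: numeral_2_eq_2)
  have "(g a, v) \<in> linked V ^^ 3" "(v, g b) \<in> linked V ^^ (n - 3)"
    using v linked_power_mono[OF _ \<open>U \<subseteq> V\<close>] by auto
  then have a_e: "(g a, g e) \<in> linked V ^^ (3 + 2)" and "(g e, g b) \<in> linked V ^^ (2 + (n - 3))"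
    using ve linked_power_trans by blast+
  moreover have "2 + (n - 3) = n - 1" using assms(7) by simp
  moreover have "(g a, g e) \<in> linked V ^^ (n - 1)"
    by (rule linked_power_pad[OF a_e _ linked_power_in(1)[OF a_e]]) (use assms(7) in auto)
  ultimately have "(g a, g e) \<in> linked V ^^ (n - 1)" "(g e, g b) \<in> linked V ^^ (n - 1)"
    by (simp_all only:)
  \<comment> \<open>c' lies between a and e or between e and b; the part on that side is the new
    line.\<close>
  then show ?thesis
    using e(1) c' abc unfolding V_def g_def by (meson linear order_trans)
qed

text \<open>Every round removes one piece and divides the radius by \<open>4 * H ^ 4\<close>, so n
  factors suffice for n pieces. With at most five pieces left, the line is padded.\<close>

lemma shorten_line_to_5:
  assumes \<gamma>: "\<gamma> \<in> P" and "1 \<le> \<delta>"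
  shows "a \<in> seg_dom \<gamma> \<Longrightarrow> b \<in> seg_dom \<gamma> \<Longrightarrow> a \<le> c \<Longrightarrow> c \<le> b \<Longrightarrow> 0 < n \<Longrightarrow>
    (seg_map \<gamma> a, seg_map \<gamma> b) \<in> linked (away (seg_map \<gamma> c) ((4 * H ^ 4) ^ n * \<delta>)) ^^ n \<Longrightarrow>
    \<exists>a' c' b'. a' \<in> seg_dom \<gamma> \<and> b' \<in> seg_dom \<gamma> \<and> a' \<le> c' \<and> c' \<le> b' \<and>
      (seg_map \<gamma> a', seg_map \<gamma> b') \<in> linked (away (seg_map \<gamma> c') \<delta>) ^^ 5"
proof (induction n arbitrary: a b c)
  case 0
  then show ?case by simp
next
  case (Suc n)
  have "1 \<le> H ^ 4" using H_ge_2 by (simp add: one_le_power)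
  then have K: "1 \<le> 4 * H ^ 4" by simp
  then have K_n: "\<delta> \<le> (4 * H ^ 4) ^ i * \<delta>" for i
    using assms(2) one_le_power[OF K, of i] mult_right_mono[of 1 "(4 * H ^ 4) ^ i" \<delta>] by simp
  show ?case
  proof (cases "6 \<le> Suc n")
    case True
    have "1 \<le> (4 * H ^ 4) ^ n * \<delta>" using K_n assms(2) order_trans by blast
    then obtain a' c' b' where "a' \<in> seg_dom \<gamma>" "b' \<in> seg_dom \<gamma>" "a' \<le> c'" "c' \<le> b'"
      "(seg_map \<gamma> a', seg_map \<gamma> b') \<in> linked (away (seg_map \<gamma> c') ((4 * H ^ 4) ^ n * \<delta>)) ^^ n"
      using shorten_line[OF \<gamma> Suc.prems(1-4) _ True, of "(4 * H ^ 4) ^ n * \<delta>"] Suc.prems(6)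
      by (auto simp only: power_Suc mult.assoc diff_Suc_1)
    then show ?thesis using Suc.IH[of a' b' c'] True by auto
  next
    case False
    have "away (seg_map \<gamma> c) ((4 * H ^ 4) ^ Suc n * \<delta>) \<subseteq> away (seg_map \<gamma> c) \<delta>"
      using K_n[of "Suc n"] by (auto simp: away_def)
    from linked_power_mono[OF Suc.prems(6) this]
    have "(seg_map \<gamma> a, seg_map \<gamma> b) \<in> linked (away (seg_map \<gamma> c) \<delta>) ^^ Suc n" .
    from linked_power_pad[OF this _ linked_power_in(1)[OF this], of 5] False
    show ?thesis using Suc.prems by auto
  qed
qed

end

section \<open>Threshold times of continuous functions\<close>

lemma exists_first_time:
  fixes f :: "real \<Rightarrow> real"
  assumes "continuous_on {a..c} f" "a \<le> c" "r \<le> f a" "f c \<le> s" "r \<le> s"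
  shows "\<exists>t\<in>{a..c}. f t \<le> s \<and> (\<forall>u\<in>{a..t}. r \<le> f u)"
proof (cases "f a \<le> s")
  case True
  then show ?thesis using assms by (intro bexI[of _ a]) auto
next
  case False
  let ?S = "{t \<in> {a..c}. f t \<le> s}"
  have "closed ?S"
    using continuous_closed_preimage[OF assms(1), of "{..s}"] by (simp add: vimage_def Int_def)
  moreover have "bounded ?S" by (rule bounded_subset[of "{a..c}"]) auto
  moreover have "c \<in> ?S" using assms by simp
  ultimately obtain T where T: "T \<in> ?S" "\<And>t. t \<in> ?S \<Longrightarrow> T \<le> t"
    using compact_attains_inf[of ?S] compact_eq_bounded_closed by blast
  have *: "\<exists>t\<in>{a..T}. f t = s"
    using IVT2'[of f T s a] continuous_on_subset[OF assms(1), of "{a..T}"] T(1) False by auto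
  then have "f T = s" using T by (metis (mono_tags, lifting) antisym_conv atLeastAtMost_iff mem_Collect_eq order.refl order_trans)
  moreover have "s < f u" if "u \<in> {a..T}" "u \<noteq> T" for u
    using T(2)[of u] T(1) that by force
  ultimately show ?thesis
    using T(1) assms(5) by (intro bexI[of _ T]) (auto, metis atLeastAtMost_iff less_eq_real_def order_trans)
qed

lemma exists_last_time:
  fixes f :: "real \<Rightarrow> real"
  assumes "continuous_on {c..b} f" "c \<le> b" "r \<le> f b" "f c \<le> s" "r \<le> s"
  shows "\<exists>t\<in>{c..b}. f t \<le> s \<and> (\<forall>u\<in>{t..b}. r \<le> f u)"
proof -
  have "continuous_on {- b..- c} (\<lambda>t. f (- t))"
    by (rule continuous_on_compose2[OF assms(1)]) (auto intro!: continuous_intros)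
  then obtain t where "t \<in> {- b..- c}" "f (- t) \<le> s" "\<forall>u\<in>{- b..t}. r \<le> f (- u)"
    using exists_first_time[of "- b" "- c" "\<lambda>t. f (- t)" r s] assms by auto
  then show ?thesis by (intro bexI[of _ "- t"]) (auto, metis atLeastAtMost_iff minus_minus neg_le_iff_le minus_le_iff)
qed

subsection \<open>Consequences of thinness\<close>

locale navigable_special_paths = special_paths +
  fixes C :: real and k :: nat
  assumes C_ge_1: "1 \<le> C" and k_ge_1: "1 \<le> k"
    and navigate: "C \<le> r \<Longrightarrow> 0 < n \<Longrightarrow> (x, y) \<in> linked (away m r) ^^ n \<Longrightarrow>
      dist m x \<le> 2 * r \<Longrightarrow> dist m y \<le> 2 * r \<Longrightarrow>
      (x, y) \<in> linked {z. r / C < dist m z \<and> dist x z \<le> C * n * r} ^^ (k * n)"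
begin

text \<open>Seven is five pieces after shortening plus one extension along \<gamma> at each
  end.\<close>

definition N :: nat where "N = k * 7"

text \<open>Navigating at radius \<open>S * \<rho>\<close> avoids radius
  \<open>S * \<rho> / C\<close>. That ball is to contain \<gamma> up to parameter distance
  \<open>(2 * real N + 2) * D\<close> from the centre, with a margin \<rho>.\<close>

definition S :: real where "S = C * (2 * H ^ 4 * (2 * real N + 2) + 1)"

text \<open>The summand with \<open>28 * C + 6\<close> pays for the 3-lines of
  \<open>no_short_line\<close>, whose sides span at most \<open>7 * C + 3\<close>,
  \<open>14 * C\<close> and \<open>7 * C + 3\<close> times \<open>S * \<rho>\<close>;
  \<open>4 * H ^ 4 + 4\<close> pays for those of \<open>no_passage\<close>.\<close>

definition A0 :: real where "A0 = H * ((28 * C + 6) * S + 4 * H ^ 4 + 4)"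

lemma H4_ge_1: "1 \<le> 4 * H ^ 4"
proof -
  have "1 \<le> H ^ 4" using H_ge_2 by (simp add: one_le_power)
  then show ?thesis by simp
qed

lemma S_ge: "C \<le> S" "1 \<le> S" "4 * H ^ 4 \<le> S"
  and S_window: "2 * H ^ 4 * (2 * real N + 2) + 1 = S / C"
proof -
  have H4: "0 \<le> H ^ 4" using H_ge_2 by simp
  have "4 * H ^ 4 \<le> 2 * H ^ 4 * (2 * real N + 2)" 
    using mult_left_mono[of 2 "2 * real N + 2" "2 * H ^ 4"] H4 by simp
  then have *: "1 \<le> 2 * H ^ 4 * (2 * real N + 2) + 1" "4 * H ^ 4 \<le> 2 * H ^ 4 * (2 * real N + 2) + 1"
    using H4 by simp_all
  show "C \<le> S" using C_ge_1 mult_left_mono[OF *(1), of C] by (simp add: S_def)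
  then show "1 \<le> S" using C_ge_1 by simp
  show "4 * H ^ 4 \<le> S"
    unfolding S_def
    by (rule order_trans[OF *(2)]) (use mult_right_mono[OF C_ge_1 order_trans[OF zero_le_one *(1)]] in \<open>simp only: mult_1\<close>)
  show "2 * H ^ 4 * (2 * real N + 2) + 1 = S / C" using C_ge_1 by (simp add: S_def)
qed

end

text \<open>\<rho> is the unit of length. Thinness is applied to subsegments whose endpoints are at
  most \<open>3 * S * \<rho>\<close> apart: then the proportional neighbourhood has radius at most
  \<rho>, and the parameter length is at most \<open>3 * H * S * \<rho>\<close>, the local
  scale.\<close>

locale locally_thin_path = navigable_special_paths +
  fixes \<gamma> :: "'a seg" and R \<rho> :: real
  assumes \<gamma>: "\<gamma> \<in> P" and \<rho>_ge_1: "1 \<le> \<rho>" and \<rho>_ge_R: "R \<le> \<rho>"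
    and locally_thin: "locally_seg (3 * H * S * \<rho>) (weakly_polygonally_Morse R (1 / (3 * S)) A0 3 P) \<gamma>"
begin

abbreviation g :: "real \<Rightarrow> 'a" where "g \<equiv> seg_map \<gamma>"

text \<open>Points of \<gamma> with parameters D apart are more than
  \<open>\<rho> + H\<^sup>2 * \<rho>\<close> apart. So a special path from one of them to a
  \<rho>-close point stays more than \<rho> away from the other.\<close>

definition D :: real where "D = 2 * H ^ 3 * \<rho>"

lemma D_gt: "H * (\<rho> + H\<^sup>2 * \<rho>) < D" "H * \<rho> < D" "\<rho> \<le> D" "H * D = 2 * H ^ 4 * \<rho>"
proof -
  have "H * \<rho> < H ^ 3 * \<rho>"
    using H_ge_2 \<rho>_ge_1 power_strict_increasing[of 1 3 H] by simp
  moreover have "\<rho> \<le> H * \<rho>" using H_ge_2 \<rho>_ge_1 by simp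
  moreover have "H * (\<rho> + H\<^sup>2 * \<rho>) = H * \<rho> + H ^ 3 * \<rho>" "H * D = 2 * H ^ 4 * \<rho>" "D = 2 * (H ^ 3 * \<rho>)"
    unfolding D_def by algebra+
  ultimately show "H * (\<rho> + H\<^sup>2 * \<rho>) < D" "H * \<rho> < D" "\<rho> \<le> D" "H * D = 2 * H ^ 4 * \<rho>"
    using \<rho>_ge_1 by linarith+
qed

text \<open>The three paths lead from the later point \<open>g s1\<close> back to
  \<open>g s2\<close>, the direction that proportional thinness prescribes. The gap D makes the
  endpoints more than \<rho> apart, so the length allowed is at least
  \<open>A0 * \<rho>\<close>.\<close>

lemma cover_directed:
  assumes s: "s1 \<in> seg_dom \<gamma>" "s2 \<in> seg_dom \<gamma>" "D \<le> s1 - s2" "s1 - s2 \<le> 3 * H * S * \<rho>"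
      "dist (g s1) (g s2) \<le> 3 * S * \<rho>"
    and h: "h1 \<in> P" "h2 \<in> P" "h3 \<in> P" "seg_start h1 = g s1" "seg_start h2 = seg_end h1"
      "seg_start h3 = seg_end h2" "seg_end h3 = g s2"
    and d: "dist (seg_start h1) (seg_end h1) \<le> d1" "dist (seg_start h2) (seg_end h2) \<le> d2"
      "dist (seg_start h3) (seg_end h3) \<le> d3" "1 \<le> d1" "1 \<le> d2" "1 \<le> d3"
      "H * (d1 + d2 + d3) \<le> A0 * \<rho>"
    and t: "s2 \<le> t" "t \<le> s1"
  shows "\<exists>x\<in>seg_image h1 \<union> seg_image h2 \<union> seg_image h3. dist x (g t) \<le> \<rho>"
proof -
  let ?p = "concat_seg (concat_seg h1 h2) h3" and ?d = "dist (g s2) (g s1)"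
  have "D > 0" using D_gt \<rho>_ge_1 by simp
  then have s21: "s2 \<le> s1" using s by simp
  have segs: "is_seg h1" "is_seg h2" "is_seg h3" using h is_seg by auto
  note c1 = seg_concat_seg[OF segs(1,2)] and c2 = seg_concat_seg[OF is_seg_concat_seg[OF segs(1,2)] segs(3)]
  have "concat_of P (Suc (Suc 1)) ?p"
    using h c1 by (intro concat_of.intros) auto
  then have "polygonal_line 3 P ?p"
    by (auto simp: polygonal_line_def intro!: exI[of _ 3] simp: numeral_3_eq_3)
  moreover have "seg_start ?p = g s1" "seg_end ?p = g s2"
    "seg_image ?p = seg_image h1 \<union> seg_image h2 \<union> seg_image h3"
    using h c1 c2 by auto
  moreover have "seg_length ?p \<le> ereal (A0 * ?d)"
  proof -
    have "seg_length ?p \<le> seg_length h1 + seg_length h2 + seg_length h3"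
      using h c1 c2 by (auto intro: order_trans[OF _ add_right_mono])
    also have "\<dots> \<le> ereal (H * d1) + ereal (H * d2) + ereal (H * d3)"
      using h d by (intro add_mono length_le) auto
    also have "\<dots> = ereal (H * (d1 + d2 + d3))" by (simp add: algebra_simps)
    also have "\<dots> \<le> ereal (A0 * ?d)"
    proof -
      have "\<rho> < ?d"
        using far_if_apart[OF \<gamma> s(2,1), of \<rho>] D_gt s(3) \<rho>_ge_1 by linarith
      moreover have "0 \<le> A0"
        using H_ge_2 C_ge_1 S_ge by (simp add: A0_def)
      ultimately have "A0 * \<rho> \<le> A0 * ?d" by (intro mult_left_mono) auto
      then show ?thesis using d by simp
    qed
    finally show ?thesis .
  qed
  moreover have "proportionally_thin (1 / (3 * S)) A0 3 P (subseg \<gamma> s2 s1)"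
  proof -
    have "weakly_polygonally_Morse R (1 / (3 * S)) A0 3 P (subseg \<gamma> s2 s1)"
      using locally_thin s s21 by (auto simp: locally_seg_def)
    \<comment> \<open>The subsegment is tested on itself; it is long enough because R \<le> \<rho>
      \<le> D.\<close>
    then have "proportionally_thin (1 / (3 * S)) A0 3 P (subseg (subseg \<gamma> s2 s1) s2 s1)"
      unfolding weakly_polygonally_Morse_def
      using s s21 D_gt \<rho>_ge_R by (auto simp: seg_subseg subseg_whole_subseg) (auto simp: dom_length_def subseg_def)
    then show ?thesis by (simp add: subseg_whole_subseg)
  qed
  ultimately have "g ` {s2..s1} \<subseteq> nbhd (1 / (3 * S) * ?d) (seg_image h1 \<union> seg_image h2 \<union> seg_image h3)"
    unfolding proportionally_thin_def seg_subseg[OF s21] by metis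
  moreover have "1 / (3 * S) * ?d \<le> \<rho>"
    using s(5) S_ge by (simp add: field_simps dist_commute)
  moreover have "g t \<in> g ` {s2..s1}" using t by simp
  ultimately obtain x where "x \<in> seg_image h1 \<union> seg_image h2 \<union> seg_image h3"
    "g t \<in> cball x (1 / (3 * S) * ?d)" "1 / (3 * S) * ?d \<le> \<rho>"
    unfolding nbhd_def by blast
  then show ?thesis by (intro bexI[of _ x]) auto
qed

lemma cover:
  assumes s: "s1 \<in> seg_dom \<gamma>" "s2 \<in> seg_dom \<gamma>" "D \<le> \<bar>s1 - s2\<bar>" "\<bar>s1 - s2\<bar> \<le> 3 * H * S * \<rho>"
      "dist (g s1) (g s2) \<le> 3 * S * \<rho>"
    and h: "h1 \<in> P" "h2 \<in> P" "h3 \<in> P" "seg_start h1 = g s1" "seg_start h2 = seg_end h1"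
      "seg_start h3 = seg_end h2" "seg_end h3 = g s2"
    and d: "dist (seg_start h1) (seg_end h1) \<le> d1" "dist (seg_start h2) (seg_end h2) \<le> d2"
      "dist (seg_start h3) (seg_end h3) \<le> d3" "1 \<le> d1" "1 \<le> d2" "1 \<le> d3"
      "H * (d1 + d2 + d3) \<le> A0 * \<rho>"
    and t: "min s1 s2 \<le> t" "t \<le> max s1 s2"
  shows "\<exists>x\<in>seg_image h1 \<union> seg_image h2 \<union> seg_image h3. dist x (g t) \<le> \<rho>"
proof (cases "s2 \<le> s1")
  case True
  then show ?thesis using cover_directed[OF s(1,2) _ _ s(5) h d] s t by auto
next
  case False
  have segs: "is_seg h1" "is_seg h2" "is_seg h3" using h is_seg by auto
  note rev = seg_reverse_seg[OF segs(1)] seg_reverse_seg[OF segs(2)] seg_reverse_seg[OF segs(3)]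
  have "\<exists>x\<in>seg_image (reverse_seg h3) \<union> seg_image (reverse_seg h2) \<union> seg_image (reverse_seg h1).
      dist x (g t) \<le> \<rho>"
    by (rule cover_directed[of s2 s1 _ _ _ d3 d2 d1])
      (use s h d t False reverse in \<open>auto simp: rev dist_commute add_ac\<close>)
  then show ?thesis by (auto simp: rev)
qed

lemma dist_g_le:
  assumes "s \<in> seg_dom \<gamma>" "t \<in> seg_dom \<gamma>" "\<bar>s - t\<bar> \<le> x * D" "1 \<le> x"
  shows "dist (g s) (g t) \<le> 2 * x * H ^ 4 * \<rho>"
proof -
  have "1 * 1 \<le> x * D" using assms(4) D_gt \<rho>_ge_1 by (intro mult_mono) auto
  then have "dist (g s) (g t) \<le> H * (x * D)"
    using upper[OF \<gamma> assms(1-3)] by simp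
  also have "\<dots> = x * (H * D)" by simp
  also have "\<dots> = 2 * x * H ^ 4 * \<rho>" unfolding D_gt(4) by simp
  finally show ?thesis .
qed

text \<open>By thinness the part of \<open>h\<close> between \<open>\<gamma>(s\<^sub>1)\<close> and \<open>\<gamma>(s\<^sub>2)\<close> passes near \<open>\<gamma>(t)\<close>. Since \<open>h\<close> also
  ends at \<open>\<gamma>(t)\<close>, it cannot be far from there, at \<open>\<gamma>(s\<^sub>2)\<close>, in between.\<close>

lemma no_passage:
  assumes h: "h \<in> P" "seg_end h = g t" "p \<in> seg_dom h" "q \<in> seg_dom h" "p \<le> q"
    and s: "s1 \<in> seg_dom \<gamma>" "s2 \<in> seg_dom \<gamma>" "\<bar>s1 - t\<bar> = D" "\<bar>s2 - t\<bar> = D" "s1 \<noteq> s2"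
    and near: "dist (seg_map h p) (g s1) \<le> \<rho>" "dist (seg_map h q) (g s2) \<le> \<rho>"
  shows False
proof -
  have t: "min s1 s2 \<le> t" "t \<le> max s1 s2" "\<bar>s1 - s2\<bar> = 2 * D" using s by auto
  have t_dom: "t \<in> seg_dom \<gamma>" using in_seg_dom_between s(1,2) t(1,2) by (metis max_def min_def)
  have far: "\<rho> + H\<^sup>2 * \<rho> < dist (g s1) (g t)" "\<rho> + H\<^sup>2 * \<rho> < dist (g s2) (g t)"
  proof -
    have "0 \<le> H\<^sup>2 * \<rho>" using \<rho>_ge_1 by simp
    then show "\<rho> + H\<^sup>2 * \<rho> < dist (g s1) (g t)" "\<rho> + H\<^sup>2 * \<rho> < dist (g s2) (g t)"
      using far_if_apart[OF \<gamma> s(1) t_dom, of "\<rho> + H\<^sup>2 * \<rho>"]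
        far_if_apart[OF \<gamma> s(2) t_dom, of "\<rho> + H\<^sup>2 * \<rho>"] D_gt(1) s \<rho>_ge_1 by linarith+
  qed
  obtain h1 h3 where h13: "h1 \<in> P" "seg_start h1 = g s1" "seg_end h1 = seg_map h p"
    "h3 \<in> P" "seg_start h3 = seg_map h q" "seg_end h3 = g s2"
    using connected by metis
  let ?h2 = "subseg h p q"
  have ds: "dist (g s1) (g s2) \<le> 4 * H ^ 4 * \<rho>"
    using dist_g_le[OF s(1,2), of 2] t(3) by simp
  have "\<exists>x\<in>seg_image h1 \<union> seg_image ?h2 \<union> seg_image h3. dist x (g t) \<le> \<rho>"
  proof (rule cover[OF s(1,2), of _ _ _ \<rho> "4 * H ^ 4 * \<rho> + 2 * \<rho>" \<rho>])
    show "D \<le> \<bar>s1 - s2\<bar>" using t D_gt \<rho>_ge_1 by simp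
    have 4: "4 * H ^ 4 * \<rho> \<le> S * \<rho>" using S_ge \<rho>_ge_1 by (intro mult_right_mono) auto
    have "2 * D \<le> H * D" using H_ge_2 D_gt \<rho>_ge_1 by (intro mult_right_mono) auto
    also have "\<dots> \<le> S * \<rho>" using D_gt 4 S_ge \<rho>_ge_1 H_ge_2 by simp
    also have "\<dots> \<le> 3 * H * S * \<rho>"
      using mult_right_mono[of 1 "3 * H" "S * \<rho>"] H_ge_2 S_ge \<rho>_ge_1 by (simp add: mult.assoc)
    finally show "\<bar>s1 - s2\<bar> \<le> 3 * H * S * \<rho>" using t by simp
    have "0 \<le> S * \<rho>" using S_ge \<rho>_ge_1 by simp
    then show "dist (g s1) (g s2) \<le> 3 * S * \<rho>" using ds 4 by linarith
    have "dist (seg_map h p) (seg_map h q) \<le> dist (seg_map h p) (g s1) + dist (g s1) (g s2) + dist (seg_map h q) (g s2)"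
      using dist_triangle[of "seg_map h p" "seg_map h q" "g s1"] dist_triangle[of "g s1" "seg_map h q" "g s2"]
      by (simp add: dist_commute)
    then show "dist (seg_start ?h2) (seg_end ?h2) \<le> 4 * H ^ 4 * \<rho> + 2 * \<rho>"
      using ds near by (simp add: seg_subseg h(5))
    have "4 * H ^ 4 + 4 \<le> (28 * C + 6) * S + 4 * H ^ 4 + 4" using C_ge_1 S_ge by simp
    then have "H * \<rho> * (4 * H ^ 4 + 4) \<le> H * \<rho> * ((28 * C + 6) * S + 4 * H ^ 4 + 4)"
      using H_ge_2 \<rho>_ge_1 by (intro mult_left_mono) auto
    then show "H * (\<rho> + (4 * H ^ 4 * \<rho> + 2 * \<rho>) + \<rho>) \<le> A0 * \<rho>" by (simp add: A0_def algebra_simps)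
    show "1 \<le> 4 * H ^ 4 * \<rho> + 2 * \<rho>" using H_ge_2 \<rho>_ge_1 by (simp add: add_increasing)
  qed (use h13 near \<rho>_ge_1 h t subseg in \<open>auto simp: seg_subseg dist_commute\<close>)
  then obtain x where x: "x \<in> seg_image h1 \<union> seg_image ?h2 \<union> seg_image h3" "dist x (g t) \<le> \<rho>" by blast
  consider "x \<in> seg_image h1" | "x \<in> seg_image h3" | u where "p \<le> u" "u \<le> q" "x = seg_map h u"
    using x(1) h(5) by (auto simp: seg_subseg)
  then show False
  proof cases
    case 1
    then have "dist (g s1) x \<le> H\<^sup>2 * \<rho>"
      using dist_in_special_path(1)[OF h13(1) _ \<rho>_ge_1 1] h13 near by (simp add: dist_commute)
    then show False using far(1) x(2) dist_triangle[of "g s1" "g t" x] by simp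
  next
    case 2
    then have "dist (g s2) x \<le> H\<^sup>2 * \<rho>"
      using dist_in_special_path(2)[OF h13(4) _ \<rho>_ge_1 2] h13 near by (simp add: dist_commute)
    then show False using far(2) x(2) dist_triangle[of "g s2" "g t" x] by simp
  next
    case 3
    have u: "u \<in> seg_dom h" using in_seg_dom_between h 3 by blast
    have hi: "dom_hi h \<in> seg_dom h" "q \<le> dom_hi h" "seg_map h (dom_hi h) = g t"
      using is_seg[OF h(1)] h by (auto simp: is_seg_def seg_dom_def seg_end_def)
    have "\<bar>u - dom_hi h\<bar> \<le> H * \<rho>"
      using lower[OF h(1) u hi(1) _ \<rho>_ge_1] x(2) 3 hi by simp
    then have "\<bar>q - dom_hi h\<bar> \<le> H * \<rho>" using 3 hi by simp
    moreover have "1 \<le> H * \<rho>" using H_ge_2 \<rho>_ge_1 mult_mono[of 1 H 1 \<rho>] by simp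
    ultimately have "dist (seg_map h q) (g t) \<le> H\<^sup>2 * \<rho>"
      using upper[OF h(1) h(4) hi(1)] hi by (simp add: power2_eq_square mult.assoc)
    then show False using far(2) near(2) dist_triangle3[of "g s2" "g t" "seg_map h q"] by simp
  qed
qed

text \<open>\<open>no_passage\<close> forbids visits to the two sides in either order.\<close>

lemma near_one_side_only:
  assumes h: "h \<in> P" "seg_end h = g t" "x \<in> seg_image h" "y \<in> seg_image h"
    and t: "t - D \<in> seg_dom \<gamma>" "t + D \<in> seg_dom \<gamma>"
    and near: "dist x (g (t - D)) \<le> \<rho>" "dist y (g (t + D)) \<le> \<rho>"
  shows False
proof -
  obtain p q where pq: "p \<in> seg_dom h" "q \<in> seg_dom h" "x = seg_map h p" "y = seg_map h q"
    using h by (auto simp: seg_image_def)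
  have "0 < D" using D_gt \<rho>_ge_1 by simp
  then have D: "\<bar>t - D - t\<bar> = D" "\<bar>t + D - t\<bar> = D" "t - D \<noteq> t + D" "t + D \<noteq> t - D" by auto
  show False
  proof (cases "p \<le> q")
    case True
    show False using no_passage[OF h(1,2) pq(1,2) True t D(1-3)] near pq(3,4) by simp
  next
    case False
    then have "q \<le> p" by simp
    show False using no_passage[OF h(1,2) pq(2,1) \<open>q \<le> p\<close> t(2,1) D(2,1,4)] near pq(3,4) by simp
  qed
qed

end

section \<open>Excluding lines around a point of \<gamma>\<close>

context locally_thin_path begin

text \<open>A single special path becomes a 3-line by adding two trivial pieces at
  \<open>g t\<close>, which add no point to its image.\<close>

lemma near_from_end:
  assumes h: "h \<in> P" "seg_start h = g s" "seg_end h = g t"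
    and st: "s \<in> seg_dom \<gamma>" "t \<in> seg_dom \<gamma>" "D \<le> \<bar>s - t\<bar>" "dist (g s) (g t) \<le> 3 * S * \<rho>"
    and u: "min s t \<le> u" "u \<le> max s t"
  shows "\<exists>x\<in>seg_image h. dist x (g u) \<le> \<rho>"
proof -
  have S: "1 \<le> 3 * S * \<rho>" "\<rho> \<le> S * \<rho>"
    using S_ge \<rho>_ge_1 mult_mono[of 1 "3 * S" 1 \<rho>] by simp_all
  have "\<exists>x\<in>seg_image h \<union> seg_image (trivial_seg 0 (g t)) \<union> seg_image (trivial_seg 0 (g t)). dist x (g u) \<le> \<rho>"
  proof (rule cover[OF st(1,2,3) _ st(4), of _ _ _ "3 * S * \<rho>" 1 1])
    show "\<bar>s - t\<bar> \<le> 3 * H * S * \<rho>"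
      using lower[OF \<gamma> st(1,2,4) S(1)] by (simp add: mult.assoc mult.left_commute)
    have "3 * S * \<rho> + 2 \<le> ((28 * C + 6) * S + 4 * H ^ 4 + 4) * \<rho>"
    proof -
      have "3 * S \<le> (28 * C + 6) * S" using S_ge C_ge_1 by (intro mult_right_mono) auto
      then have "3 * S + 2 \<le> (28 * C + 6) * S + 4 * H ^ 4 + 4" using H4_ge_1 by linarith
      then have "(3 * S + 2) * \<rho> \<le> ((28 * C + 6) * S + 4 * H ^ 4 + 4) * \<rho>"
        using \<rho>_ge_1 by (intro mult_right_mono) auto
      then show ?thesis using \<rho>_ge_1 by (simp add: distrib_right)
    qed
    then show "H * (3 * S * \<rho> + 1 + 1) \<le> A0 * \<rho>"
      using H_ge_2 unfolding A0_def mult.assoc by (intro mult_left_mono) (auto simp: mult.assoc)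
  qed (use h st u S trivial in \<open>auto simp: seg_trivial_seg\<close>)
  moreover have "g t \<in> seg_image h" using h seg_end_in_image is_seg by metis
  ultimately show ?thesis by (auto simp: seg_trivial_seg)
qed

abbreviation r0 :: real where "r0 \<equiv> S * \<rho>"

text \<open>Along the vertices \<open>v\<^sub>i\<close> of the line, the special path from \<open>v\<^sub>i\<close> to \<open>\<gamma>(c + 2iD)\<close> never comes
  near \<open>\<gamma>(c + 2iD + D)\<close>: this propagates because two consecutive such paths that avoid the same point
  of \<open>\<gamma>\<close> would form, with the edge of the line, a 3-line contradicting thinness. At the last vertex,
  which is on \<open>\<gamma>\<close> to the right of everything, it is impossible.\<close>

lemma no_short_line:
  assumes ab: "a \<in> seg_dom \<gamma>" "b \<in> seg_dom \<gamma>" "a \<le> c" "c \<le> b"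
    and close: "dist (g c) (g a) \<le> 2 * r0" "dist (g c) (g b) \<le> 2 * r0"
    and line: "(g a, g b) \<in> linked {z. r0 / C < dist (g c) z \<and> dist (g a) z \<le> C * 7 * r0} ^^ N"
  shows False
proof -
  define V where "V = {z. r0 / C < dist (g c) z \<and> dist (g a) z \<le> C * 7 * r0}"
  \<comment> \<open>Spacing 2D makes \<open>t i + D\<close> equal to \<open>t (Suc i) - D\<close>:
    the right neighbour of one test point is the left neighbour of the next.\<close>
  define t where "t i = c + 2 * real i * D" for i
  have D0: "0 < D" "1 \<le> D" using D_gt \<rho>_ge_1 by simp_all
  have window: "H * ((2 * real N + 2) * D) + \<rho> = r0 / C"
  proof -
    have "H * ((2 * real N + 2) * D) = (2 * real N + 2) * (H * D)" by simp
    then have "H * ((2 * real N + 2) * D) + \<rho> = (2 * H ^ 4 * (2 * real N + 2) + 1) * \<rho>"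
      unfolding D_gt(4) by (simp add: algebra_simps)
    then show ?thesis unfolding S_window by simp
  qed
  have N: "0 < N" using k_ge_1 by (simp add: N_def)
  have c: "c \<in> seg_dom \<gamma>" using in_seg_dom_between ab by blast
  obtain f where f: "f 0 = g a" "f N = g b" "\<And>i. i < N \<Longrightarrow> (f i, f (Suc i)) \<in> linked V"
    using line unfolding V_def[symmetric] by (auto simp: relpow_fun_conv)
  have f_V: "f i \<in> V" if "i \<le> N" for i
    using f(3)[of i] f(3)[of "i - 1"] linked_in N that by (cases "i < N") fastforce+
  have W1: "1 \<le> (2 * real N + 2) * D" using D0 mult_mono[of 1 "2 * real N + 2" 1 D] by simp
  \<comment> \<open>The ends of the line lie outside the avoided ball, so \<gamma> extends beyond
    all test points on both sides of c.\<close>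
  have "(2 * real N + 2) * D < \<bar>c - a\<bar>" "(2 * real N + 2) * D < \<bar>c - b\<bar>"
    using apart_if_far[OF \<gamma> c ab(1) _ W1] apart_if_far[OF \<gamma> c ab(2) _ W1]
      f_V[of 0] f_V[of N] f(1,2) window \<rho>_ge_1 by (auto simp: V_def)
  then have room: "a + (2 * real N + 2) * D < c" "c + (2 * real N + 2) * D < b" using ab by auto
  have in_window: "s \<in> seg_dom \<gamma> \<and> dist (g c) (g s) + \<rho> \<le> r0 / C"
    if "\<bar>c - s\<bar> \<le> (2 * real N + 2) * D" for s
  proof -
    have "s \<in> seg_dom \<gamma>" by (rule in_seg_dom_between[OF ab(1,2)]) (use that room in auto)
    then show ?thesis using upper[OF \<gamma> c _ that W1] window by auto
  qed
  have t_window: "t i + d \<in> seg_dom \<gamma> \<and> dist (g c) (g (t i + d)) + \<rho> \<le> r0 / C"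
    if "i \<le> N" "\<bar>d\<bar> \<le> 2 * D" for i d
  proof (rule in_window)
    have "2 * real i * D \<le> 2 * real N * D" "0 \<le> 2 * real i * D" using that D0 by simp_all
    then show "\<bar>c - (t i + d)\<bar> \<le> (2 * real N + 2) * D"
      using that(2) unfolding t_def distrib_right by linarith
  qed
  note t_dom = conjunct1[OF t_window] and t_near = conjunct2[OF t_window]
  have r0: "1 \<le> r0" "0 \<le> r0" "r0 / C \<le> r0"
    using S_ge \<rho>_ge_1 mult_mono[of 1 S 1 \<rho>] C_ge_1 by (simp_all add: field_simps mult_left_mono)
  have "\<rho> < dist x (g (t i + D))"
    if "i \<le> N" "h \<in> P" "seg_start h = f i" "seg_end h = g (t i)" "x \<in> seg_image h" for i h x
    using that
  proof (induction i arbitrary: h x)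
    case 0
    \<comment> \<open>The path from \<open>g a\<close> comes near \<open>g (t 0 - D)\<close>, since
      a lies further left; this excludes the right side.\<close>
    have "dist (g a) (g (t 0)) \<le> 3 * S * \<rho>" using close r0 by (simp add: t_def dist_commute)
    moreover have "D \<le> \<bar>a - t 0\<bar>" "min a (t 0) \<le> t 0 - D" "t 0 - D \<le> max a (t 0)"
    proof -
      have "0 \<le> 2 * real N * D" using D0 by simp
      then have "a + 2 * D < c" using room(1) unfolding distrib_right by linarith
      then show "D \<le> \<bar>a - t 0\<bar>" "min a (t 0) \<le> t 0 - D" "t 0 - D \<le> max a (t 0)"
        using D0 by (auto simp: t_def)
    qed
    ultimately obtain y where y: "y \<in> seg_image h" "dist y (g (t 0 - D)) \<le> \<rho>"
      using near_from_end[OF 0(2) _ 0(4), of a "t 0 - D"] 0(3) f(1) ab(1) c by (auto simp: t_def)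
    show ?case
      using near_one_side_only[OF 0(2,4) y(1) 0(5)] t_dom[of 0 "- D"] t_dom[of 0 D] D0 y(2)
      by (fastforce simp: not_less)
  next
    case (Suc i)
    have t_Suc: "t (Suc i) - D = t i + D" "t (Suc i) = t i + 2 * D" by (simp_all add: t_def algebra_simps)
    obtain h1 where h1: "h1 \<in> P" "seg_start h1 = f i" "seg_end h1 = g (t i)" using connected by blast
    obtain e where e: "e \<in> P" "seg_start e = f i" "seg_end e = f (Suc i)" "seg_image e \<subseteq> V"
      using f(3)[of i] Suc.prems(1) by (auto simp: linked_def)
    have dom: "t i \<in> seg_dom \<gamma>" "t (Suc i) \<in> seg_dom \<gamma>" "t i + D \<in> seg_dom \<gamma>" "t (Suc i) + D \<in> seg_dom \<gamma>"
      using t_dom[of i 0] t_dom[of "Suc i" 0] t_dom[of i D] t_dom[of "Suc i" D] Suc.prems(1) D0 by auto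
    have ds: "dist (g (t i)) (g (t (Suc i))) \<le> 4 * H ^ 4 * \<rho>"
      using dist_g_le[OF dom(1,2), of 2] t_Suc D0 by simp
    have 4: "4 * H ^ 4 * \<rho> \<le> r0" using S_ge \<rho>_ge_1 by (intro mult_right_mono) auto
    have f_t: "dist (f j) (g (t j)) \<le> (7 * C + 3) * r0" if "j \<le> N" for j
    proof -
      have "dist (f j) (g (t j)) \<le> dist (f j) (g a) + dist (g a) (g c) + dist (g c) (g (t j))"
        using dist_triangle[of "f j" "g (t j)" "g a"] dist_triangle[of "g a" "g (t j)" "g c"] by simp
      also have "dist (f j) (g a) \<le> C * 7 * r0" using f_V[OF that] by (simp add: V_def dist_commute)
      also have "dist (g c) (g (t j)) \<le> r0" using t_near[of j 0] that D0 r0 \<rho>_ge_1 by simp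
      finally show ?thesis using close by (simp add: dist_commute algebra_simps)
    qed
    have "\<exists>x\<in>seg_image (reverse_seg h1) \<union> seg_image e \<union> seg_image h. dist x (g (t i + D)) \<le> \<rho>"
    proof (rule cover[OF dom(1,2), of _ _ _ "(7 * C + 3) * r0" "14 * C * r0" "(7 * C + 3) * r0"])
      show "D \<le> \<bar>t i - t (Suc i)\<bar>" using t_Suc D0 by simp
      have "2 * D \<le> H * D" using H_ge_2 D0 by (intro mult_right_mono) auto
      also have "\<dots> \<le> 4 * H ^ 4 * \<rho>" unfolding D_gt(4) using H_ge_2 \<rho>_ge_1 by simp
      also have "\<dots> \<le> r0" by (rule 4)
      also have "\<dots> \<le> 3 * H * S * \<rho>"
        using mult_right_mono[of 1 "3 * H" r0] H_ge_2 r0 by (simp add: mult.assoc)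
      finally show "\<bar>t i - t (Suc i)\<bar> \<le> 3 * H * S * \<rho>" using t_Suc D0 by simp
      show "dist (g (t i)) (g (t (Suc i))) \<le> 3 * S * \<rho>" using ds 4 r0 by linarith
      have "dist (f i) (f (Suc i)) \<le> dist (g a) (f i) + dist (g a) (f (Suc i))"
        by (rule dist_triangle3)
      then show "dist (seg_start e) (seg_end e) \<le> 14 * C * r0"
        using f_V[of i] f_V[of "Suc i"] Suc.prems(1) e by (simp add: V_def)
      show "dist (seg_start (reverse_seg h1)) (seg_end (reverse_seg h1)) \<le> (7 * C + 3) * r0"
        using f_t[of i] Suc.prems(1) h1 is_seg by (simp add: seg_reverse_seg dist_commute)
      show "dist (seg_start h) (seg_end h) \<le> (7 * C + 3) * r0"
        using f_t[of "Suc i"] Suc.prems by simp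
      have "1 * 1 \<le> (7 * C + 3) * r0" "1 * 1 \<le> 14 * C * r0"
        using C_ge_1 r0 by (intro mult_mono; simp)+
      then show "1 \<le> (7 * C + 3) * r0" "1 \<le> 14 * C * r0" "1 \<le> (7 * C + 3) * r0" by simp_all
      have "0 \<le> H * ((4 * H ^ 4 + 4) * \<rho>)" using H_ge_2 \<rho>_ge_1 by simp
      then show "H * ((7 * C + 3) * r0 + 14 * C * r0 + (7 * C + 3) * r0) \<le> A0 * \<rho>"
        by (simp add: A0_def algebra_simps)
    qed (use h1 e Suc.prems reverse is_seg t_Suc D0 in \<open>auto simp: seg_reverse_seg\<close>)
    then obtain y where y: "y \<in> seg_image h1 \<union> seg_image e \<union> seg_image h" "dist y (g (t i + D)) \<le> \<rho>"
      using h1 is_seg by (auto simp: seg_reverse_seg)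
    \<comment> \<open>Induction rules out h1 and the avoided ball rules out e. So h comes near the
      left neighbour of \<open>t (Suc i)\<close>, and hence not near the right one.\<close>
    have "y \<notin> seg_image h1"
      using Suc.IH[OF _ h1, of y] Suc.prems(1) y(2) by auto
    moreover have "y \<notin> seg_image e"
    proof
      assume "y \<in> seg_image e"
      then have "r0 / C < dist (g c) y" using e(4) by (auto simp: V_def)
      then show False
        using t_near[of i D] Suc.prems(1) D0 y(2) dist_triangle[of "g c" y "g (t i + D)"]
        by (simp add: dist_commute)
    qed
    ultimately have "y \<in> seg_image h" using y by blast
    moreover have "dist y (g (t (Suc i) - D)) \<le> \<rho>" using y(2) unfolding t_Suc(1) .
    ultimately have "\<not> dist x (g (t (Suc i) + D)) \<le> \<rho>"
      using near_one_side_only[OF Suc.prems(2,4) _ Suc.prems(5), of y] dom(3,4) unfolding t_Suc(1) by blast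
    then show ?case by simp
  qed
  note away_from_right = this
  obtain h where h: "h \<in> P" "seg_start h = g b" "seg_end h = g (t N)" using connected by blast
  have t_N: "t N + 2 * D < b" using room(2) by (simp add: t_def algebra_simps)
  have "dist (g b) (g (t N)) \<le> 3 * S * \<rho>"
    using dist_triangle3[of "g b" "g (t N)" "g c"] close t_near[of N 0] r0 \<rho>_ge_1 D0 by simp
  then obtain y where "y \<in> seg_image h" "dist y (g (t N + D)) \<le> \<rho>"
    using near_from_end[OF h ab(2), of "t N + D"] t_dom[of N 0] t_N D0 by auto
  then show False using away_from_right[OF order.refl h(1) _ h(3)] f(2) h(2) by force
qed

text \<open>Navigability wants endpoints within \<open>2 * r0\<close> of the centre, but a and b may
  be far out. Following \<gamma> inwards, without entering the ball of radius \<open>r0\<close>,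
  costs one piece at each end.\<close>

lemma no_surrounding_line:
  assumes ab: "a \<in> seg_dom \<gamma>" "b \<in> seg_dom \<gamma>" "a \<le> c" "c \<le> b"
    and line: "(g a, g b) \<in> linked (away (g c) r0) ^^ 5"
  shows False
proof -
  let ?U = "away (g c) r0"
  have r0: "0 \<le> r0" "C \<le> r0"
    using S_ge \<rho>_ge_1 C_ge_1 mult_mono[of C S 1 \<rho>] by simp_all
  have c: "c \<in> seg_dom \<gamma>" using in_seg_dom_between ab by blast
  have ends: "r0 \<le> dist (g c) (g a)" "r0 \<le> dist (g c) (g b)"
    using linked_power_in[OF line] by (simp_all add: away_def)
  have "\<exists>a'\<in>{a..c}. dist (g c) (g a') \<le> 2 * r0 \<and> (\<forall>u\<in>{a..a'}. r0 \<le> dist (g c) (g u))"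
    by (intro exists_first_time continuous_dist_special \<gamma> ab c ends)
      (simp_all only: dist_self, (use r0 in linarith)+)
  then obtain a' where a': "a' \<in> {a..c}" "dist (g c) (g a') \<le> 2 * r0" "g ` {a..a'} \<subseteq> ?U"
    unfolding away_def by blast
  have "\<exists>b'\<in>{c..b}. dist (g c) (g b') \<le> 2 * r0 \<and> (\<forall>u\<in>{b'..b}. r0 \<le> dist (g c) (g u))"
    by (intro exists_last_time continuous_dist_special \<gamma> ab c ends)
      (simp_all only: dist_self, (use r0 in linarith)+)
  then obtain b' where b': "b' \<in> {c..b}" "dist (g c) (g b') \<le> 2 * r0" "g ` {b'..b} \<subseteq> ?U"
    unfolding away_def by blast
  have dom: "a' \<in> seg_dom \<gamma>" "b' \<in> seg_dom \<gamma>"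
    using in_seg_dom_between[OF ab(1) c, of a'] in_seg_dom_between[OF c ab(2), of b'] a'(1) b'(1) by auto
  have "(g a, g a') \<in> linked ?U" "(g b', g b) \<in> linked ?U"
    using a' b' by (auto intro!: linked_subseg \<gamma> ab dom)
  then have "(g a', g a) \<in> linked ?U ^^ 1" "(g b, g b') \<in> linked ?U ^^ 1"
    using linked_sym by auto
  then have "(g a', g b') \<in> linked ?U ^^ (1 + 5 + 1)"
    using linked_power_trans line by blast
  then have "(g a', g b') \<in> linked ?U ^^ 7" by simp
  from navigate[OF r0(2) _ this] have "(g a', g b') \<in>
      linked {z. r0 / C < dist (g c) z \<and> dist (g a') z \<le> C * 7 * r0} ^^ N"
    using a' b' by (simp add: N_def)
  then show False using no_short_line[OF dom _ _ a'(2) b'(2)] a'(1) b'(1) by auto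
qed

end

subsection \<open>The Morse property\<close>

lemma quasi_geodesic_segD:
  assumes "quasi_geodesic_seg Q q p"
  shows "1 \<le> Q" "0 \<le> q" "is_seg p" "continuous_on (seg_dom p) (seg_map p)"
    and "s \<in> seg_dom p \<Longrightarrow> t \<in> seg_dom p \<Longrightarrow> dist (seg_map p s) (seg_map p t) \<le> Q * \<bar>s - t\<bar> + q"
    and "s \<in> seg_dom p \<Longrightarrow> t \<in> seg_dom p \<Longrightarrow> \<bar>s - t\<bar> \<le> Q * (dist (seg_map p s) (seg_map p t) + q)"
    and "seg_length p \<le> ereal (Q * (Q + q) * dist (seg_start p) (seg_end p) + (Q * (2 * (Q + q)) + 3) * (Q + q))"
proof -
  note q = assms[unfolded quasi_geodesic_seg_def quasi_geodesic_def Let_def]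
  show Q: "1 \<le> Q" and "0 \<le> q" and p: "is_seg p" and "continuous_on (seg_dom p) (seg_map p)"
    using q by auto
  show "dist (seg_map p s) (seg_map p t) \<le> Q * \<bar>s - t\<bar> + q" if "s \<in> seg_dom p" "t \<in> seg_dom p"
    using q that by blast
  show "\<bar>s - t\<bar> \<le> Q * (dist (seg_map p s) (seg_map p t) + q)" if "s \<in> seg_dom p" "t \<in> seg_dom p"
  proof -
    have "(1 / Q) * \<bar>s - t\<bar> - q \<le> dist (seg_map p s) (seg_map p t)" using q that by blast
    then show ?thesis using Q by (simp add: field_simps)
  qed
  have "dom_lo p \<in> seg_dom p" "dom_hi p \<in> seg_dom p" "dom_lo p \<le> dom_hi p"
    using p by (auto simp: is_seg_def seg_dom_def)
  then show "seg_length p \<le> ereal (Q * (Q + q) * dist (seg_start p) (seg_end p) + (Q * (2 * (Q + q)) + 3) * (Q + q))"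
    using q by (simp add: seg_length_def seg_start_def seg_end_def)
qed

section \<open>The Morse gauge\<close>

context navigable_special_paths begin

text \<open>The stretch of \<eta> to be cut has parameter length at most
  \<open>Q * ((2 * H\<^sup>2 + 5) * d)\<close>; with this many equal parts, each parameter step
  contributes at most \<open>d / (4 * H\<^sup>2)\<close> to a jump. The scale absorbs q, so this
  integer depends on Q alone and the gauge stays continuous in q.\<close>

definition pieces :: "real \<Rightarrow> nat" where
  "pieces Q = nat \<lceil>4 * H\<^sup>2 * Q\<^sup>2 * (2 * H\<^sup>2 + 5)\<rceil>"

text \<open>Half of the distance d from \<eta> must be at least the radius from which
  \<open>shorten_line_to_5\<close> descends to \<open>S * \<rho>\<close>, and the jumps along \<eta>
  need d to be at least \<open>4 * H\<^sup>2\<close>. The factor \<open>1 + q\<close> in the gauge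
  makes d at least \<open>4 * H\<^sup>2 * q\<close> too.\<close>

definition scale :: "real \<Rightarrow> real \<Rightarrow> real" where
  "scale \<rho> Q = 2 * ((4 * H ^ 4) ^ (pieces Q + 2) * (S * \<rho>)) + 4 * H\<^sup>2"

text \<open>With B = \<open>scale \<rho> Q * (1 + q)\<close>, this is the cost of reaching \<eta>
  within B and then following it for a parameter length of at most
  \<open>Q * (2 * B + q)\<close>.\<close>

definition gauge :: "real \<Rightarrow> real \<Rightarrow> real \<Rightarrow> real" where
  "gauge \<rho> Q q = scale \<rho> Q * (1 + q) + Q * (Q * (2 * (scale \<rho> Q * (1 + q)) + q)) + q"

lemma scale_mono:
  assumes "0 \<le> \<rho>" "0 \<le> Q" "Q \<le> Q'"
  shows "scale \<rho> Q \<le> scale \<rho> Q'"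
proof -
  have "Q\<^sup>2 \<le> Q'\<^sup>2" using assms by (intro power_mono) auto
  then have "pieces Q \<le> pieces Q'"
    unfolding pieces_def by (intro nat_mono ceiling_mono mult_right_mono mult_left_mono) auto
  then have "(4 * H ^ 4) ^ (pieces Q + 2) \<le> (4 * H ^ 4) ^ (pieces Q' + 2)"
    by (intro power_increasing H4_ge_1) auto
  then show ?thesis
    unfolding scale_def using assms S_ge by (intro add_right_mono mult_left_mono mult_right_mono) auto
qed

lemma scale_nonneg: "0 \<le> \<rho> \<Longrightarrow> 0 \<le> scale \<rho> Q"
  using S_ge H4_ge_1 by (simp add: scale_def)

lemma Morse_gauge_gauge:
  assumes "0 \<le> \<rho>"
  shows "Morse_gauge (gauge \<rho>)"
  unfolding Morse_gauge_def
proof (intro conjI allI impI)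
  note E = scale_nonneg[OF assms]
  show "0 \<le> gauge \<rho> Q q" if "1 \<le> Q" "0 \<le> q" for Q q
    using that E[of Q] by (simp add: gauge_def)
  show "mono_on {1..} (\<lambda>Q. gauge \<rho> Q q)" if "0 \<le> q" for q
  proof (rule mono_onI)
    fix Q Q' :: real assume Q: "Q \<in> {1..}" "Q' \<in> {1..}" "Q \<le> Q'"
    have "scale \<rho> Q * (1 + q) \<le> scale \<rho> Q' * (1 + q)"
      using Q that scale_mono[OF assms, of Q Q'] by (intro mult_right_mono) auto
    then show "gauge \<rho> Q q \<le> gauge \<rho> Q' q"
      unfolding gauge_def using Q that E[of Q] E[of Q']
      by (intro add_mono mult_mono) auto
  qed
  show "mono_on {0..} (gauge \<rho> Q)" if "1 \<le> Q" for Q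
  proof (rule mono_onI)
    fix q q' :: real assume q: "q \<in> {0..}" "q' \<in> {0..}" "q \<le> q'"
    have "scale \<rho> Q * (1 + q) \<le> scale \<rho> Q * (1 + q')"
      using q E[of Q] by (intro mult_left_mono) auto
    then show "gauge \<rho> Q q \<le> gauge \<rho> Q q'"
      unfolding gauge_def using q that E[of Q]
      by (intro add_mono mult_mono) auto
  qed
  show "continuous_on {0..} (gauge \<rho> Q)" for Q
    unfolding gauge_def by (intro continuous_intros)
qed

end

section \<open>Quasi-geodesics with endpoints on \<gamma>\<close>

context locally_thin_path begin

text \<open>Let c be the parameter in [s, t] at which \<gamma> is farthest from \<eta>, at distance
  d. By maximality a jump of at most d reaches \<eta> from every point of \<gamma> between s and t.
  Two such jumps, one on each side of c, joined along \<eta>, surround \<open>g c\<close> by a line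
  outside radius d / 2.\<close>

lemma near_quasi_geodesic:
  assumes st: "s \<in> seg_dom \<gamma>" "t \<in> seg_dom \<gamma>" "s \<le> u" "u \<le> t"
    and \<eta>: "quasi_geodesic_seg Q q \<eta>" "g s \<in> seg_image \<eta>" "g t \<in> seg_image \<eta>"
  shows "infdist (g u) (seg_image \<eta>) \<le> scale \<rho> Q * (1 + q)"
proof (rule ccontr)
  assume "\<not> ?thesis"
  then have u: "scale \<rho> Q * (1 + q) < infdist (g u) (seg_image \<eta>)" by simp
  note qg = quasi_geodesic_segD[OF \<eta>(1)]
  let ?A = "seg_image \<eta>"
  have A: "compact ?A" "?A \<noteq> {}"
    using qg(4) \<eta>(2) by (auto simp: seg_image_def seg_dom_def intro: compact_continuous_image)
  have sub: "{s..t} \<subseteq> seg_dom \<gamma>" using st by (auto simp: seg_dom_def)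
  have "continuous_on {s..t} (\<lambda>u. infdist (g u) ?A)"
    by (intro continuous_intros continuous_on_subset[OF continuous[OF \<gamma>] sub])
  then obtain c where c: "c \<in> {s..t}" "\<And>u. u \<in> {s..t} \<Longrightarrow> infdist (g u) ?A \<le> infdist (g c) ?A"
    using continuous_attains_sup[of "{s..t}" "\<lambda>u. infdist (g u) ?A"] st by auto
  define d where "d = infdist (g c) ?A"
  have c_dom: "c \<in> seg_dom \<gamma>" using c(1) sub by auto
  have "scale \<rho> Q * (1 + q) \<le> d" using u c(2)[of u] st by (auto simp: d_def)
  moreover have E: "0 \<le> scale \<rho> Q" using scale_nonneg \<rho>_ge_1 by simp
  moreover have "scale \<rho> Q * (1 + q) = scale \<rho> Q + scale \<rho> Q * q" by (simp add: algebra_simps)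
  moreover have "0 \<le> scale \<rho> Q * q" using E qg(2) by simp
  ultimately have "scale \<rho> Q \<le> d" "scale \<rho> Q * q \<le> d" by linarith+
  moreover have big: "4 * H\<^sup>2 \<le> scale \<rho> Q" "2 * ((4 * H ^ 4) ^ (pieces Q + 2) * r0) \<le> scale \<rho> Q"
    using S_ge \<rho>_ge_1 H4_ge_1 by (simp_all add: scale_def)
  moreover have "4 * H\<^sup>2 * q \<le> scale \<rho> Q * q" using big(1) qg(2) by (rule mult_right_mono)
  ultimately have d: "4 * H\<^sup>2 \<le> d" "4 * H\<^sup>2 * q \<le> d" "(4 * H ^ 4) ^ (pieces Q + 2) * r0 \<le> d / 2"
    by linarith+
  have H2: "4 \<le> H\<^sup>2" using H_ge_2 power_mono[of 2 H 2] by simp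
  then have H0: "0 < H\<^sup>2" "H \<noteq> 0" by auto
  have d1: "1 \<le> d" "q \<le> d" using d(1,2) H2 qg(2) mult_right_mono[of 1 "4 * H\<^sup>2" q] by linarith+
  define U where "U = away (g c) (d / 2)"
  have dist_A: "d \<le> dist (g c) z" if "z \<in> ?A" for z
    using infdist_le[OF that] by (simp add: d_def)
  have A_U: "?A \<subseteq> U" using dist_A d1 by (force simp: U_def away_def)
  \<comment> \<open>The place to leave \<gamma> is at distance \<open>(H\<^sup>2 + 1) * d\<close>
    from \<open>g c\<close>: the special path to \<eta> strays at most \<open>H\<^sup>2 * d\<close>
    and so keeps distance d. If \<open>g w\<close> is no farther than that, w itself serves, as
    \<open>g w\<close> is on \<eta>.\<close>
  have bridge: "\<exists>a x. min w c \<le> a \<and> a \<le> max w c \<and> x \<in> seg_dom \<eta> \<and> dist (g c) (g a) \<le> (H\<^sup>2 + 1) * d \<and>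
      dist (g a) (seg_map \<eta> x) \<le> d \<and> (g a, seg_map \<eta> x) \<in> linked U" if w: "w \<in> {s..t}" "g w \<in> ?A" for w
  proof (cases "dist (g c) (g w) \<le> (H\<^sup>2 + 1) * d")
    case True
    obtain x where "x \<in> seg_dom \<eta>" "g w = seg_map \<eta> x" using w(2) by (auto simp: seg_image_def)
    moreover have "(g w, g w) \<in> linked U" using w(2) A_U linked_refl by blast
    ultimately show ?thesis
      using True d1 by (intro exI[of _ w] exI[of _ x]) auto
  next
    case False
    have "min w c \<in> seg_dom \<gamma>" "max w c \<in> seg_dom \<gamma>" using w(1) c_dom sub by (auto simp: min_def max_def)
    then have "continuous_on {min w c..max w c} (\<lambda>u. dist (g c) (g u))"
      by (rule continuous_dist_special[OF \<gamma>])
    moreover have "min (dist (g c) (g (min w c))) (dist (g c) (g (max w c))) \<le> (H\<^sup>2 + 1) * d \<and>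
        (H\<^sup>2 + 1) * d \<le> max (dist (g c) (g (min w c))) (dist (g c) (g (max w c)))"
    proof -
      have "0 \<le> (H\<^sup>2 + 1) * d" using d1 by simp
      then show ?thesis using False by (cases "w \<le> c") (auto simp: min_def max_def)
    qed
    ultimately obtain a where a: "a \<in> {min w c..max w c}" "dist (g c) (g a) = (H\<^sup>2 + 1) * d"
      using IVT_between[of "min w c" "max w c" "\<lambda>u. dist (g c) (g u)" "(H\<^sup>2 + 1) * d"]
        min.cobounded1[of w c] max.cobounded1[of w c] by (meson order_trans)
    then have "a \<in> {s..t}" using w(1) c(1) by auto
    then have "infdist (g a) ?A \<le> d" using c(2) by (simp add: d_def)
    moreover obtain x where "x \<in> ?A" "\<And>z. z \<in> ?A \<Longrightarrow> dist (g a) x \<le> dist (g a) z"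
      using continuous_attains_inf[OF A, of "dist (g a)"]
        continuous_on_dist[OF continuous_on_const continuous_on_id, of ?A "g a"] by auto
    moreover from this have "dist (g a) x \<le> infdist (g a) ?A"
      using A by (auto simp: infdist_def intro!: cINF_greatest)
    ultimately have x: "x \<in> ?A" "dist (g a) x \<le> d" by auto
    have "(g a, x) \<in> linked U"
    proof (rule linked_if_close[OF x(2) d1(1)])
      show "cball (g a) (H\<^sup>2 * d) \<subseteq> U"
      proof
        fix z assume "z \<in> cball (g a) (H\<^sup>2 * d)"
        then have "d \<le> dist (g c) z"
          using dist_triangle[of "g c" "g a" z] a(2) by (simp add: dist_commute algebra_simps)
        then show "z \<in> U" using d1 by (simp add: U_def away_def)
      qed
    qed
    moreover obtain p where "p \<in> seg_dom \<eta>" "x = seg_map \<eta> p" using x(1) by (auto simp: seg_image_def)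
    ultimately show ?thesis using a x(2) by (intro exI[of _ a] exI[of _ p]) auto
  qed
  obtain a x where a: "s \<le> a" "a \<le> c" "x \<in> seg_dom \<eta>" "dist (g c) (g a) \<le> (H\<^sup>2 + 1) * d"
      "dist (g a) (seg_map \<eta> x) \<le> d" "(g a, seg_map \<eta> x) \<in> linked U"
    using bridge[of s] \<eta>(2) st c(1) by auto
  obtain b y where b: "c \<le> b" "b \<le> t" "y \<in> seg_dom \<eta>" "dist (g c) (g b) \<le> (H\<^sup>2 + 1) * d"
      "dist (g b) (seg_map \<eta> y) \<le> d" "(g b, seg_map \<eta> y) \<in> linked U"
    using bridge[of t] \<eta>(3) st c(1) by auto
  define n where "n = pieces Q"
  have "0 < 4 * H\<^sup>2 * Q\<^sup>2 * (2 * H\<^sup>2 + 5)" using H2 qg(1) by (intro mult_pos_pos add_nonneg_pos) auto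
  then have n: "0 < n" "4 * H\<^sup>2 * Q\<^sup>2 * (2 * H\<^sup>2 + 5) \<le> real n"
    by (simp_all add: n_def pieces_def)
  define f where "f j = seg_map \<eta> (x + (y - x) * (real j / real n))" for j
  have f_dom: "x + (y - x) * (real j / real n) \<in> seg_dom \<eta>" if "j \<le> n" for j
  proof -
    have "real j / real n \<in> {0..1}" using that n(1) by simp
    moreover have eq: "x + (y - x) * r = (1 - r) *\<^sub>R x + r *\<^sub>R y" for r :: real
      by (simp add: algebra_simps)
    moreover have "convex (seg_dom \<eta>)" by (simp add: seg_dom_def)
    ultimately show ?thesis
      using convexD_alt[of "seg_dom \<eta>" x y "real j / real n"] a(3) b(3) unfolding eq atLeastAtMost_iff by blast
  qed
  \<comment> \<open>The factor counts two distances \<open>(H\<^sup>2 + 1) * d\<close> from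
    \<open>g c\<close>, two jumps of at most d, and q \<le> d.\<close>
  have xy: "\<bar>y - x\<bar> \<le> Q * ((2 * H\<^sup>2 + 5) * d)"
  proof -
    have "dist (seg_map \<eta> y) (seg_map \<eta> x) \<le>
        dist (seg_map \<eta> y) (g b) + dist (g b) (g c) + dist (g c) (g a) + dist (g a) (seg_map \<eta> x)"
      by (smt (verit) dist_triangle)
    also have "\<dots> \<le> d + (H\<^sup>2 + 1) * d + (H\<^sup>2 + 1) * d + d"
      using a b by (intro add_mono) (simp_all add: dist_commute)
    finally have "dist (seg_map \<eta> y) (seg_map \<eta> x) + q \<le> (2 * H\<^sup>2 + 5) * d"
      using d1 by (simp add: algebra_simps)
    then have "Q * (dist (seg_map \<eta> y) (seg_map \<eta> x) + q) \<le> Q * ((2 * H\<^sup>2 + 5) * d)"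
      using qg(1) by (intro mult_left_mono) auto
    then show ?thesis using qg(6)[OF b(3) a(3)] by linarith
  qed
  \<comment> \<open>Points of \<eta> are at least d away from \<open>g c\<close>, and a jump of
    \<open>d / (2 * H\<^sup>2)\<close> is bridged within d / 2. Half of the jump allows for the
    parameter step, half for q.\<close>
  have "(f j, f (Suc j)) \<in> linked U" if j: "j < n" for j
  proof (rule linked_if_close)
    have "(x + (y - x) * (real j / real n)) - (x + (y - x) * (real (Suc j) / real n)) = (x - y) / real n"
      using n(1) by (simp add: field_simps)
    then have "dist (f j) (f (Suc j)) \<le> Q * (\<bar>y - x\<bar> / real n) + q"
      using qg(5)[OF f_dom f_dom, of j "Suc j"] j n(1) by (simp add: f_def abs_minus_commute)
    also have "Q * (\<bar>y - x\<bar> / real n) \<le> d / (4 * H\<^sup>2)"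
    proof -
      have "Q * \<bar>y - x\<bar> * (4 * H\<^sup>2) \<le> Q * (Q * ((2 * H\<^sup>2 + 5) * d)) * (4 * H\<^sup>2)"
        using xy qg(1) by (intro mult_right_mono mult_left_mono) auto
      also have "\<dots> = (4 * H\<^sup>2 * Q\<^sup>2 * (2 * H\<^sup>2 + 5)) * d" by (simp add: power2_eq_square)
      also have "\<dots> \<le> real n * d" using n(2) d1 by (intro mult_right_mono) auto
      finally show ?thesis using n(1) H0 by (simp add: field_simps)
    qed
    also have "q \<le> d / (4 * H\<^sup>2)" using d(2) H0 by (simp add: field_simps)
    finally show "dist (f j) (f (Suc j)) \<le> d / (2 * H\<^sup>2)" by simp
    have "2 * H\<^sup>2 \<le> d" using d(1) H0(1) by linarith
    then show "1 \<le> d / (2 * H\<^sup>2)" using H0 by (simp add: field_simps)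
    have "H\<^sup>2 * (d / (2 * H\<^sup>2)) = d / 2" using H0 by (simp add: field_simps)
    then show "cball (f j) (H\<^sup>2 * (d / (2 * H\<^sup>2))) \<subseteq> U"
    proof (simp only:, intro subsetI)
      fix z assume "z \<in> cball (f j) (d / 2)"
      moreover have "f j \<in> ?A" using f_dom[of j] j by (simp add: f_def seg_image_def)
      ultimately show "z \<in> U"
        using dist_A[of "f j"] dist_triangle[of "g c" "f j" z] by (simp add: U_def away_def dist_commute)
    qed
  qed
  moreover have "f 0 = seg_map \<eta> x" "f n = seg_map \<eta> y" using n(1) by (simp_all add: f_def)
  ultimately have "(seg_map \<eta> x, seg_map \<eta> y) \<in> linked U ^^ n"
    unfolding relpow_fun_conv by (intro exI[of _ f]) simp
  \<comment> \<open>The two jumps add one piece each, whence the exponent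
    \<open>pieces Q + 2\<close> in \<open>scale\<close>.\<close>
  moreover have "(g a, seg_map \<eta> x) \<in> linked U ^^ 1" "(seg_map \<eta> y, g b) \<in> linked U ^^ 1"
    using a b linked_sym by auto
  ultimately have "(g a, g b) \<in> linked U ^^ (1 + n + 1)" using linked_power_trans by blast
  then have "(g a, g b) \<in> linked U ^^ (n + 2)" by simp
  moreover have "U \<subseteq> away (g c) ((4 * H ^ 4) ^ (n + 2) * r0)"
    using d(3) by (auto simp: U_def away_def n_def)
  ultimately have line: "(g a, g b) \<in> linked (away (g c) ((4 * H ^ 4) ^ (n + 2) * r0)) ^^ (n + 2)"
    by (rule linked_power_mono)
  have "1 \<le> r0" using S_ge \<rho>_ge_1 mult_mono[of 1 S 1 \<rho>] by simp
  moreover have "a \<in> seg_dom \<gamma>" "b \<in> seg_dom \<gamma>" using sub a b c(1) by auto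
  ultimately show False
    using shorten_line_to_5[OF \<gamma> _ _ _ a(2) b(1) _ line] no_surrounding_line by auto
qed

text \<open>By connectedness of \<open>[s, t]\<close>, some point of \<open>\<gamma>\<close> is close to \<open>\<eta>\<close> both before and after a given
  time.\<close>

lemma quasi_geodesic_near:
  assumes st: "s \<in> seg_dom \<gamma>" "t \<in> seg_dom \<gamma>" "s \<le> t"
    and \<eta>: "quasi_geodesic_seg Q q \<eta>" "{seg_start \<eta>, seg_end \<eta>} = {g s, g t}"
  shows "seg_image \<eta> \<subseteq> nbhd (gauge \<rho> Q q) (g ` {s..t})"
proof
  fix x assume "x \<in> seg_image \<eta>"
  then obtain y where y: "y \<in> seg_dom \<eta>" "x = seg_map \<eta> y" by (auto simp: seg_image_def)
  note qg = quasi_geodesic_segD[OF \<eta>(1)]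
  define B where "B = scale \<rho> Q * (1 + q)"
  have B0: "0 \<le> B" using scale_nonneg[of \<rho> Q] \<rho>_ge_1 qg(2) by (simp add: B_def)
  let ?l = "dom_lo \<eta>" and ?h = "dom_hi \<eta>"
  have lh: "?l \<le> y" "y \<le> ?h" using y(1) by (auto simp: seg_dom_def)
  have sub: "{s..t} \<subseteq> seg_dom \<gamma>" using st by (auto simp: seg_dom_def)
  have "seg_start \<eta> \<in> seg_image \<eta>" "seg_end \<eta> \<in> seg_image \<eta>"
    using seg_start_in_image seg_end_in_image qg(3) by auto
  then have ends: "g s \<in> seg_image \<eta>" "g t \<in> seg_image \<eta>" using \<eta>(2) by (auto simp: doubleton_eq_iff)
  define T where "T I = {u \<in> {s..t}. infdist (g u) (seg_map \<eta> ` I) \<le> B}" for I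
  have closed: "closed (T I)" for I
  proof -
    have "continuous_on {s..t} (\<lambda>u. infdist (g u) (seg_map \<eta> ` I))"
      by (intro continuous_intros continuous_on_subset[OF continuous[OF \<gamma>] sub])
    then show ?thesis
      using continuous_closed_preimage[of "{s..t}" _ "{..B}"] by (simp add: T_def vimage_def Int_def)
  qed
  \<comment> \<open>\<open>infdist\<close> to the empty set is 0, hence the condition that I is
    nonempty.\<close>
  have attained: "\<exists>p\<in>I. dist (g u) (seg_map \<eta> p) \<le> B"
    if "u \<in> {s..t}" "infdist (g u) (seg_map \<eta> ` I) \<le> B" "compact I" "I \<noteq> {}" "I \<subseteq> seg_dom \<eta>" for u I
  proof -
    have "compact (seg_map \<eta> ` I)"
      using qg(4) that by (intro compact_continuous_image) (auto intro: continuous_on_subset)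
    then obtain z where "z \<in> seg_map \<eta> ` I" "\<And>z'. z' \<in> seg_map \<eta> ` I \<Longrightarrow> dist (g u) z \<le> dist (g u) z'"
      using continuous_attains_inf[of "seg_map \<eta> ` I" "dist (g u)"] \<open>I \<noteq> {}\<close>
        continuous_on_dist[OF continuous_on_const continuous_on_id, of "seg_map \<eta> ` I" "g u"] by auto
    moreover from this have "dist (g u) z \<le> infdist (g u) (seg_map \<eta> ` I)"
      by (auto simp: infdist_def intro!: cINF_greatest)
    ultimately have "z \<in> seg_map \<eta> ` I" "dist (g u) z \<le> B"
      using \<open>infdist (g u) (seg_map \<eta> ` I) \<le> B\<close> by auto
    then show ?thesis by auto
  qed
  have "{s..t} \<subseteq> T {?l..y} \<union> T {y..?h}"
  proof
    fix u assume u: "u \<in> {s..t}"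
    have "infdist (g u) (seg_map \<eta> ` {?l..?h}) \<le> B"
      using near_quasi_geodesic[OF st(1,2) _ _ \<eta>(1) ends, of u] u
      by (simp add: B_def seg_image_def seg_dom_def)
    from attained[OF u this] obtain p where "p \<in> {?l..?h}" "dist (g u) (seg_map \<eta> p) \<le> B"
      using lh by (auto simp: seg_dom_def)
    moreover from this have "infdist (g u) (seg_map \<eta> ` I) \<le> B" if "p \<in> I" for I
      using that infdist_le[of "seg_map \<eta> p" "seg_map \<eta> ` I" "g u"] by auto
    moreover have "p \<in> {?l..y} \<or> p \<in> {y..?h}" using calculation(1) by auto
    ultimately show "u \<in> T {?l..y} \<union> T {y..?h}"
      using u unfolding T_def by blast
  qed
  \<comment> \<open>The endpoints of \<eta> are \<open>g s\<close> and \<open>g t\<close> in some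
    order, so each of the two sets contains s or t.\<close>
  moreover have "T {?l..y} \<inter> {s..t} \<noteq> {}" "T {y..?h} \<inter> {s..t} \<noteq> {}"
  proof -
    have "infdist z (seg_map \<eta> ` I) \<le> B" if "z = seg_map \<eta> p" "p \<in> I" for z p I
      using that B0 by simp
    moreover have "seg_start \<eta> = seg_map \<eta> ?l" "seg_end \<eta> = seg_map \<eta> ?h"
      by (simp_all add: seg_start_def seg_end_def)
    ultimately have "infdist (seg_start \<eta>) (seg_map \<eta> ` {?l..y}) \<le> B" "infdist (seg_end \<eta>) (seg_map \<eta> ` {y..?h}) \<le> B"
      using lh by fastforce+
    then show "T {?l..y} \<inter> {s..t} \<noteq> {}" "T {y..?h} \<inter> {s..t} \<noteq> {}"
      using \<eta>(2) st(3) by (auto simp: T_def doubleton_eq_iff)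
  qed
  ultimately obtain u where u: "u \<in> T {?l..y}" "u \<in> T {y..?h}"
    using connected_Icc[of s t] closed unfolding connected_closed by blast
  then have u_st: "u \<in> {s..t}" by (simp add: T_def)
  obtain p where p: "p \<in> {?l..y}" "dist (g u) (seg_map \<eta> p) \<le> B"
    using attained[OF u_st, of "{?l..y}"] u(1) lh by (auto simp: T_def seg_dom_def)
  obtain r where r: "r \<in> {y..?h}" "dist (g u) (seg_map \<eta> r) \<le> B"
    using attained[OF u_st, of "{y..?h}"] u(2) lh by (auto simp: T_def seg_dom_def)
  have dom: "p \<in> seg_dom \<eta>" "r \<in> seg_dom \<eta>" using p(1) r(1) lh by (auto simp: seg_dom_def)
  have "dist (seg_map \<eta> p) (seg_map \<eta> r) \<le> 2 * B"
    using dist_triangle3[of "seg_map \<eta> p" "seg_map \<eta> r" "g u"] p(2) r(2) by simp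
  then have "\<bar>p - r\<bar> \<le> Q * (2 * B + q)"
    using qg(1) by (intro order_trans[OF qg(6)[OF dom]] mult_left_mono) auto
  \<comment> \<open>y lies between p and r.\<close>
  then have "\<bar>p - y\<bar> \<le> Q * (2 * B + q)" using p(1) r(1) by auto
  then have "dist (seg_map \<eta> p) x \<le> Q * (Q * (2 * B + q)) + q"
    unfolding y(2) using qg(1) by (intro order_trans[OF qg(5)[OF dom(1) y(1)]] add_right_mono mult_left_mono) auto
  then have "dist (g u) x \<le> gauge \<rho> Q q"
    using p(2) dist_triangle[of "g u" x "seg_map \<eta> p"] by (simp add: gauge_def B_def)
  then show "x \<in> nbhd (gauge \<rho> Q q) (g ` {s..t})" using u_st by (auto simp: nbhd_def)
qed

end

section \<open>From path systems to the constants \<open>H\<close>, \<open>C\<close> and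
  \<open>k\<close>\<close>

lemma special_paths_if_path_system:
  assumes "path_system P" "undirected P"
  shows "\<exists>H. special_paths P H"
proof -
  note ps = assms(1)[unfolded path_system_def]
  obtain l \<kappa> where q: "\<And>p. p \<in> P \<Longrightarrow> quasi_geodesic_seg l \<kappa> p" using ps by blast
  have triv: "trivial_seg a x \<in> P" for a x using ps by blast
  note qg = quasi_geodesic_segD[OF q]
  have l: "1 \<le> l" "0 \<le> \<kappa>" using qg(1,2) triv by blast+
  define k1 where "k1 = l * (l + \<kappa>)"
  define k2 where "k2 = (l * (2 * (l + \<kappa>)) + 3) * (l + \<kappa>)"
  \<comment> \<open>All summands are nonnegative, so H bounds each of the sums
    \<open>l + \<kappa>\<close>, \<open>l + l * \<kappa>\<close> and \<open>k1 + k2\<close> to which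
    \<open>absorb\<close> is applied.\<close>
  define H where "H = 2 + (l + \<kappa>) + l * (1 + \<kappa>) + (k1 + k2)"
  have k: "0 \<le> k1" "0 \<le> k2" "0 \<le> l * (1 + \<kappa>)" using l by (simp_all add: k1_def k2_def)
  have absorb: "x * d + y \<le> H * d" if "1 \<le> d" "x + y \<le> H" "0 \<le> y" for x y d
  proof -
    have "x * d + y \<le> (x + y) * d" using that mult_left_mono[of 1 d y] by (simp add: algebra_simps)
    also have "\<dots> \<le> H * d" using that by (intro mult_right_mono) auto
    finally show ?thesis .
  qed
  have "special_paths P H"
  proof
    show "2 \<le> H" using l k by (simp add: H_def)
    show "trivial_seg a x \<in> P" for a x by (rule triv)
    show "\<exists>h\<in>P. seg_start h = x \<and> seg_end h = y" for x y using ps by blast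
    show "reverse_seg h \<in> P" if "h \<in> P" for h using assms(2) that by (simp add: undirected_def)
    show "is_seg h" "continuous_on (seg_dom h) (seg_map h)" if "h \<in> P" for h using qg(3,4) that by auto
    show "subseg h s t \<in> P" if "h \<in> P" "s \<in> seg_dom h" "t \<in> seg_dom h" "s \<le> t" for h s t
      using ps that by blast
  next
    fix h s t and d :: real
    assume h: "h \<in> P" "s \<in> seg_dom h" "t \<in> seg_dom h" and d: "\<bar>s - t\<bar> \<le> d" "1 \<le> d"
    have "dist (seg_map h s) (seg_map h t) \<le> l * \<bar>s - t\<bar> + \<kappa>" using qg(5) h by blast
    also have "\<dots> \<le> l * d + \<kappa>" using l d by (intro add_right_mono mult_left_mono) auto
    also have "\<dots> \<le> H * d" using d l k by (intro absorb) (auto simp: H_def)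
    finally show "dist (seg_map h s) (seg_map h t) \<le> H * d" .
  next
    fix h s t and d :: real
    assume h: "h \<in> P" "s \<in> seg_dom h" "t \<in> seg_dom h" and d: "dist (seg_map h s) (seg_map h t) \<le> d" "1 \<le> d"
    have "\<bar>s - t\<bar> \<le> l * (dist (seg_map h s) (seg_map h t) + \<kappa>)" using qg(6) h by blast
    also have "\<dots> \<le> l * (d + \<kappa>)" using l d by (intro mult_left_mono) auto
    also have "\<dots> = l * d + l * \<kappa>" by (simp add: algebra_simps)
    also have "\<dots> \<le> H * d" using d l k by (intro absorb) (auto simp: H_def algebra_simps)
    finally show "\<bar>s - t\<bar> \<le> H * d" .
  next
    fix h and d :: real
    assume h: "h \<in> P" and d: "dist (seg_start h) (seg_end h) \<le> d" "1 \<le> d"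
    have "seg_length h \<le> ereal (k1 * dist (seg_start h) (seg_end h) + k2)"
      unfolding k1_def k2_def by (rule qg(7)[OF h])
    also have "\<dots> \<le> ereal (k1 * d + k2)" using d k by (simp add: mult_left_mono)
    also have "\<dots> \<le> ereal (H * d)" using absorb[of d k1 k2] d l k by (simp add: H_def)
    finally show "seg_length h \<le> ereal (H * d)" .
  qed
  then show ?thesis by blast
qed

lemma navigable_special_paths_if_navigable:
  assumes "special_paths P H" "navigable P"
  shows "\<exists>C k. navigable_special_paths P H C k"
proof -
  interpret special_paths P H by fact
  obtain C k where C: "1 \<le> C" "1 \<le> k" and nav: "\<And>r m n \<alpha>. C \<le> r \<Longrightarrow>
      polygonal_line n P \<alpha> \<Longrightarrow> r \<le> infdist m (seg_image \<alpha>) \<Longrightarrow>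
      dist (seg_start \<alpha>) m \<le> 2 * r \<Longrightarrow> dist (seg_end \<alpha>) m \<le> 2 * r \<Longrightarrow>
      \<exists>p. polygonal_line (k * n) P p \<and> seg_start p = seg_start \<alpha> \<and> seg_end p = seg_end \<alpha> \<and>
        seg_length p \<le> ereal (C * real n * r) \<and> seg_image p \<inter> cball m (r / C) = {}"
    using assms(2) unfolding navigable_def by metis
  have "navigable_special_paths P H C k"
  proof
    fix r n x y m
    assume r: "C \<le> r" and n: "0 < n" and line: "(x, y) \<in> linked (away m r) ^^ n"
      and close: "dist m x \<le> 2 * r" "dist m y \<le> 2 * r"
    obtain n' where n': "n = Suc n'" using n gr0_implies_Suc by blast
    obtain \<alpha> where \<alpha>: "concat_of P n \<alpha>" "seg_start \<alpha> = x" "seg_end \<alpha> = y" "seg_image \<alpha> \<subseteq> away m r"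
      using concat_of_if_linked_power[OF line[unfolded n']] n' by auto
    \<comment> \<open>This rules out the default value 0 of \<open>infdist\<close>.\<close>
    have "seg_image \<alpha> \<noteq> {}"
      using linked_power_if_concat_of[OF \<alpha>(1)] seg_start_in_image by blast
    then have "r \<le> infdist m (seg_image \<alpha>)"
      using \<alpha>(4) by (auto simp: infdist_def away_def intro!: cINF_greatest)
    then obtain p where p: "polygonal_line (k * n) P p" "seg_start p = x" "seg_end p = y"
        "seg_length p \<le> ereal (C * real n * r)" "seg_image p \<inter> cball m (r / C) = {}"
      using nav[OF r, of n \<alpha> m] \<alpha> close by (auto simp: polygonal_line_def dist_commute)
    let ?V = "{z. r / C < dist m z \<and> dist x z \<le> C * real n * r}"
    have V: "seg_image p \<subseteq> ?V"
      using p(5) dist_seg_start_le_seg_length[OF _ p(4)] p(2) by (auto simp: disjoint_iff not_le)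
    obtain j where j: "j \<le> k * n" "concat_of P j p" using p(1) by (auto simp: polygonal_line_def)
    have "(x, y) \<in> linked ?V ^^ j" "is_seg p"
      using linked_power_if_concat_of[OF j(2)] V p by auto
    moreover have "x \<in> ?V" using V seg_start_in_image[OF \<open>is_seg p\<close>] p(2) by blast
    ultimately show "(x, y) \<in> linked ?V ^^ (k * n)" using j(1) linked_power_pad by blast
  qed (use C in auto)
  then show ?thesis by blast
qed

theorem theorem1p8:
  fixes P :: "'a::metric_space seg set"
  assumes "geodesic_space (UNIV :: 'a set)"
    and "path_system P" and "navigable P" and "undirected P"
  shows "\<forall>R\<ge>0. \<exists>\<epsilon>0>0. \<exists>A0\<ge>1. \<exists>L\<ge>0. \<exists>M. Morse_gauge M \<and>
    (\<forall>\<gamma>\<in>P. locally_seg L (weakly_polygonally_Morse R \<epsilon>0 A0 3 P) \<gamma> \<longrightarrow>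
       Morse_quasi_geodesic M (seg_dom \<gamma>) (seg_map \<gamma>))"
proof (intro allI impI)
  fix R :: real assume R: "0 \<le> R"
  obtain H where "special_paths P H" using special_paths_if_path_system assms by blast
  then obtain C k where "navigable_special_paths P H C k"
    using navigable_special_paths_if_navigable assms(3) by blast
  then interpret navigable_special_paths P H C k .
  obtain l \<kappa> where q: "\<And>p. p \<in> P \<Longrightarrow> quasi_geodesic_seg l \<kappa> p"
    using assms(2) unfolding path_system_def by blast
  \<comment> \<open>The unit \<open>1 + R\<close> is at least 1, which lets H absorb additive
    constants, and at least R, which makes the tested subsegments long enough.\<close>
  have "Morse_quasi_geodesic (gauge (1 + R)) (seg_dom \<gamma>) (seg_map \<gamma>)"
    if "\<gamma> \<in> P" "locally_seg (3 * H * S * (1 + R)) (weakly_polygonally_Morse R (1 / (3 * S)) A0 3 P) \<gamma>" for \<gamma>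
  proof -
    interpret locally_thin_path P H C k \<gamma> R "1 + R"
      by unfold_locales (use that R in auto)
    show ?thesis
      unfolding Morse_quasi_geodesic_def
      using q[OF that(1)] quasi_geodesic_near by (auto simp: quasi_geodesic_seg_def)
  qed
  moreover have "1 * 1 \<le> A0"
    unfolding A0_def using H_ge_2 C_ge_1 S_ge by (intro mult_mono) auto
  ultimately show "\<exists>\<epsilon>0>0. \<exists>A0\<ge>1. \<exists>L\<ge>0. \<exists>M. Morse_gauge M \<and>
    (\<forall>\<gamma>\<in>P. locally_seg L (weakly_polygonally_Morse R \<epsilon>0 A0 3 P) \<gamma> \<longrightarrow>
       Morse_quasi_geodesic M (seg_dom \<gamma>) (seg_map \<gamma>))"
    using Morse_gauge_gauge[of "1 + R"] R S_ge H_ge_2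
    by (intro exI[of _ "1 / (3 * S)"] exI[of _ A0] exI[of _ "3 * H * S * (1 + R)"] exI[of _ "gauge (1 + R)"] conjI)
      auto
qed

end
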